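(* Let $X$ and $Y$ be uniformly locally finite metric spaces. Then every strongly continuous compact preserving $^*$-homomorphism $\Phi\colon\mathrm{BD}(X)\to\mathrm{BD}(Y)$ is coarse-like; that is, for all $\varepsilon,r>0$ there is $s>0$ so that for every contraction $a\in\mathrm{BD}(X)$ with $\mathrm{prop}(a)\leq r$ there is $c\in\mathrm{BD}(Y)$ with $\mathrm{prop}(c)\leq s$ and $\|\Phi(a)-c\|\leq\varepsilon$.
   Context: A metric space $(X,d)$ is uniformly locally finite (u.l.f.) if $\sup_{x\in X}|B_r(x)|<\infty$ for all $r>0$, where $B_r(x)$ is the closed ball of radius $r$ centered at $x$. $H$ is a separable infinite-dimensional Hilbert space. $\ell_2(X,H)$ is the Hilbert space of square-summable functions $X\to H$, and $\delta_x\otimes\eta$ is the function with value $\eta$ at $x$ and $0$ elsewhere. For $a\in\mathcal B(\ell_2(X,H))$ and $x,y\in X$, $a_{xy}\in\mathcal B(H)$ is determined by $\langle a_{xy}\xi,\eta\rangle=\langle a(\delta_x\otimes\xi),\delta_y\otimes\eta\rangle$, and $\mathrm{prop}(a)=\sup\{d(x,y)\mid a_{xy}\neq 0\}$. $\mathrm{BD}(X)$ is the norm closure of $\{a\in\mathcal B(\ell_2(X,H))\mid\mathrm{prop}(a)<\infty\}$. Strongly continuous means continuous with respect to the strong operator topologies; compact preserving means sending compact operators to compact operators. *)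

theory Defs
  imports "HOL-Analysis.Analysis"
begin

section \<open>Complex Hilbert spaces\<close>

class complex_vector = real_vector +
  fixes scaleC :: "complex \<Rightarrow> 'a \<Rightarrow> 'a"  (infixr \<open>*\<^sub>C\<close> 75)
  assumes scaleC_add_right: "c *\<^sub>C (x + y) = c *\<^sub>C x + c *\<^sub>C y"
    and scaleC_add_left: "(b + c) *\<^sub>C x = b *\<^sub>C x + c *\<^sub>C x"
    and scaleC_scaleC: "b *\<^sub>C c *\<^sub>C x = (b * c) *\<^sub>C x"
    and scaleC_one: "1 *\<^sub>C x = x"
    and scaleR_scaleC: "r *\<^sub>R x = complex_of_real r *\<^sub>C x"

global_interpretation cvec: vector_space "scaleC :: complex \<Rightarrow> 'a \<Rightarrow> 'a::complex_vector"
  by unfold_locales (simp_all add: scaleC_add_right scaleC_add_left scaleC_scaleC scaleC_one)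

text \<open>The complex inner product is linear in the first variable. The norm and the topology come
  from the real inner product \<^const>\<open>inner\<close>, which is its real part.\<close>

class complex_inner = complex_vector + real_inner +
  fixes cinner :: "'a \<Rightarrow> 'a \<Rightarrow> complex"
  assumes cinner_commute: "cinner x y = cnj (cinner y x)"
    and cinner_add_left: "cinner (x + y) z = cinner x z + cinner y z"
    and cinner_scaleC_left: "cinner (c *\<^sub>C x) y = c * cinner x y"
    and Re_cinner: "Re (cinner x y) = inner x y"

class complex_hilbert = complex_inner + complete_space

instantiation complex :: complex_hilbert
begin

definition scaleC_complex :: "complex \<Rightarrow> complex \<Rightarrow> complex" where
  "scaleC_complex c x = c * x"

definition cinner_complex :: "complex \<Rightarrow> complex \<Rightarrow> complex" where
  "cinner_complex x y = x * cnj y"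

instance
  by intro_classes
    (simp_all add: scaleC_complex_def cinner_complex_def inner_complex_def algebra_simps
      scaleR_conv_of_real)

end

definition infinite_dimensional :: "'a::complex_vector itself \<Rightarrow> bool" where
  "infinite_dimensional _ \<longleftrightarrow> (\<forall>S :: 'a set. finite S \<longrightarrow> cvec.span S \<noteq> UNIV)"

lemma cinner_scaleC_right: "cinner x (c *\<^sub>C y) = cnj c * cinner x y"
  by (metis cinner_commute cinner_scaleC_left complex_cnj_mult)

lemma cinner_add_right: "cinner x (y + z) = cinner x y + cinner x z"
  by (metis cinner_commute cinner_add_left complex_cnj_add)

lemma cinner_zero_left [simp]: "cinner 0 x = 0"
  using cinner_add_left [of 0 0 x] by simp

lemma Im_cinner: "Im (cinner x y) = inner (- \<i> *\<^sub>C x) y"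
  by (simp add: Re_cinner [symmetric] cinner_scaleC_left del: cvec.scale_minus_left)

lemma cinner_eq_iff: "(\<forall>y. cinner x y = cinner x' y) \<longleftrightarrow> x = x'"
proof
  assume "\<forall>y. cinner x y = cinner x' y"
  then have "inner (x - x') (x - x') = 0"
    by (metis Re_cinner inner_diff_left diff_self)
  then show "x = x'" by simp
qed simp

lemma cinner_eq_iff': "(\<forall>x. cinner x y = cinner x y') \<longleftrightarrow> y = y'"
  by (metis cinner_commute cinner_eq_iff)

lemma norm_scaleC: "norm (c *\<^sub>C x) = cmod c * norm (x :: 'a::complex_inner)"
proof -
  have "Im (cinner x x) = 0"
    using cinner_commute [of x x] by (metis Reals_cnj_iff complex_is_Real_iff)
  then have "cinner x x = complex_of_real (inner x x)"
    by (simp add: complex_eq_iff Re_cinner)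
  then have "cinner (c *\<^sub>C x) (c *\<^sub>C x) = (c * cnj c) * complex_of_real (inner x x)"
    by (simp add: cinner_scaleC_left cinner_scaleC_right)
  then have "inner (c *\<^sub>C x) (c *\<^sub>C x) = (cmod c)\<^sup>2 * inner x x"
    by (metis Re_cinner Re_complex_of_real complex_norm_square of_real_mult)
  then show ?thesis
    by (simp add: norm_eq_sqrt_inner real_sqrt_mult)
qed

lemma bounded_linear_scaleC: "bounded_linear (\<lambda>x :: 'a::complex_inner. c *\<^sub>C x)"
proof (rule bounded_linear_intro)
  show "c *\<^sub>C (r *\<^sub>R x) = r *\<^sub>R c *\<^sub>C x" for r and x :: 'a
    by (simp add: scaleR_scaleC mult.commute)
  show "norm (c *\<^sub>C x) \<le> norm x * cmod c" for x :: 'a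
    by (simp add: norm_scaleC)
qed (rule scaleC_add_right)


section \<open>Bounded operators\<close>

text \<open>The type \<open>'a \<Rightarrow>\<^sub>L 'b\<close> consists of real-linear maps. The complex-linear ones are singled
  out below; the operator norm does not depend on the field of scalars.\<close>

instantiation blinfun :: (real_normed_vector, complex_inner) complex_vector
begin

lift_definition scaleC_blinfun :: "complex \<Rightarrow> ('a \<Rightarrow>\<^sub>L 'b) \<Rightarrow> 'a \<Rightarrow>\<^sub>L 'b" is
  "\<lambda>c a \<xi>. c *\<^sub>C a \<xi>"
  by (rule bounded_linear_compose [OF bounded_linear_scaleC])

instance
  by intro_classes (transfer; simp add: scaleC_add_right scaleC_add_left scaleR_scaleC)+

end

definition bounded_operators :: "('a::complex_hilbert \<Rightarrow>\<^sub>L 'a) set" where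
  "bounded_operators = {a. \<forall>c \<xi>. blinfun_apply a (c *\<^sub>C \<xi>) = c *\<^sub>C blinfun_apply a \<xi>}"

definition compact_operator :: "('a::complex_hilbert \<Rightarrow>\<^sub>L 'a) \<Rightarrow> bool" where
  "compact_operator a \<longleftrightarrow> compact (closure (blinfun_apply a ` cball 0 1))"

definition adj :: "('a::complex_hilbert \<Rightarrow>\<^sub>L 'a) \<Rightarrow> 'a \<Rightarrow>\<^sub>L 'a" where
  "adj a = (THE b :: 'a \<Rightarrow>\<^sub>L 'a. \<forall>\<xi> \<eta>. cinner (a \<xi>) \<eta> = cinner \<xi> (b \<eta>))"

lemma riesz_representation:
  fixes \<phi> :: "'a::{real_inner, complete_space} \<Rightarrow> real"
  assumes "bounded_linear \<phi>"
  shows "\<exists>z. \<forall>x. \<phi> x = inner z x"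
proof -
  interpret \<phi>: bounded_linear \<phi> by fact
  obtain K where K: "\<And>x. \<bar>\<phi> x\<bar> \<le> norm x * K"
    using \<phi>.bounded by auto
  define J where "J x = (norm x)\<^sup>2 / 2 - \<phi> x" for x
  define m where "m = Inf (range J)"
  have "- K\<^sup>2 / 2 \<le> J x" for x
  proof -
    have "0 \<le> (norm x - K)\<^sup>2" by simp
    then show ?thesis
      using K [of x] by (simp add: J_def power2_eq_square algebra_simps)
  qed
  then have bdd: "bdd_below (range J)" by (auto intro!: bdd_belowI)
  then have m: "m \<le> J x" for x unfolding m_def by (auto intro: cINF_lower)
  have "\<exists>x. J x < m + inverse (real (Suc n))" for n
    using cInf_lessD [of "range J" "m + inverse (real (Suc n))"] by (auto simp: m_def)
  then obtain X where X: "\<And>n. J (X n) < m + inverse (real (Suc n))" by metis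
  have par: "(norm (x - y))\<^sup>2 \<le> 4 * (J x + J y - 2 * m)" for x y
  proof -
    have "J ((1/2) *\<^sub>R (x + y)) = (J x + J y) / 2 - (norm (x - y))\<^sup>2 / 8"
      by (simp add: J_def \<phi>.scaleR \<phi>.add power2_norm_eq_inner power_divide inner_add_left
          inner_add_right inner_diff_left inner_diff_right inner_commute field_simps)
    then show ?thesis using m [of "(1/2) *\<^sub>R (x + y)"] by argo
  qed
  have "Cauchy X"
  proof (rule metric_CauchyI)
    fix e :: real assume "e > 0"
    then obtain N where N: "inverse (real (Suc N)) < e\<^sup>2 / 8"
      using reals_Archimedean [of "e\<^sup>2 / 8"] by auto
    have "dist (X i) (X j) < e" if "N \<le> i" "N \<le> j" for i j
    proof -
      have "inverse (real (Suc i)) \<le> inverse (real (Suc N))"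
        "inverse (real (Suc j)) \<le> inverse (real (Suc N))"
        using that by (auto simp: field_simps)
      moreover have "A < E" if "A \<le> 4 * (p + q - 2 * m)" "p < m + a" "q < m + b"
        "a \<le> c" "b \<le> c" "c < E / 8" for A E a b c p q :: real
        using that by argo
      ultimately have "(norm (X i - X j))\<^sup>2 < e\<^sup>2"
        using par [of "X i" "X j"] X [of i] X [of j] N by blast
      then show ?thesis
        using \<open>e > 0\<close> by (simp add: dist_norm power_less_imp_less_base)
    qed
    then show "\<exists>M. \<forall>i\<ge>M. \<forall>j\<ge>M. dist (X i) (X j) < e" by blast
  qed
  then obtain z where z: "X \<longlonglongrightarrow> z"
    using Cauchy_convergent convergent_def by blast
  have "(\<lambda>n. J (X n)) \<longlonglongrightarrow> J z"
    unfolding J_def by (intro tendsto_intros z \<phi>.tendsto) auto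
  moreover have "(\<lambda>n. m + inverse (real (Suc n))) \<longlonglongrightarrow> m + 0"
    by (intro tendsto_intros LIMSEQ_inverse_real_of_nat)
  moreover have "J (X n) \<le> m + inverse (real (Suc n))" for n
    using X [of n] by (rule less_imp_le)
  ultimately have "J z \<le> m + 0"
    by (intro LIMSEQ_le) auto
  then have Jz: "J z \<le> J x" for x using m [of x] by simp
  have "\<phi> x = inner z x" for x
  proof (cases "x = 0")
    case False
    define d where "d = inner z x - \<phi> x"
    define t where "t = - d / (norm x)\<^sup>2"
    have nx: "(norm x)\<^sup>2 > 0" using False by simp
    have "J (z + t *\<^sub>R x) = J z + t * d + t\<^sup>2 * (norm x)\<^sup>2 / 2"
      by (simp add: J_def d_def \<phi>.scaleR \<phi>.add power2_norm_eq_inner inner_add_left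
          inner_add_right inner_commute algebra_simps power2_eq_square [of t])
    then have "0 \<le> t * d + t\<^sup>2 * (norm x)\<^sup>2 / 2" using Jz [of "z + t *\<^sub>R x"] by linarith
    also have "\<dots> = - (d\<^sup>2 / (norm x)\<^sup>2) / 2"
      using nx by (simp add: t_def power2_eq_square field_simps)
    finally have "d\<^sup>2 \<le> 0" using nx by (simp add: field_simps)
    then show ?thesis by (simp add: d_def)
  qed (simp add: \<phi>.zero)
  then show ?thesis by blast
qed

lemma adj_unique:
  fixes a b :: "'a::complex_hilbert \<Rightarrow>\<^sub>L 'a"
  assumes "\<forall>\<xi> \<eta>. cinner (a \<xi>) \<eta> = cinner \<xi> (b \<eta>)"
  shows "adj a = b"
  unfolding adj_def
proof (rule the_equality, rule assms)
  fix b' :: "'a \<Rightarrow>\<^sub>L 'a" assume "\<forall>\<xi> \<eta>. cinner (a \<xi>) \<eta> = cinner \<xi> (b' \<eta>)"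
  then show "b' = b"
    using assms by (metis blinfun_eqI cinner_eq_iff')
qed

lemma cinner_adj:
  fixes a :: "'a::complex_hilbert \<Rightarrow>\<^sub>L 'a"
  assumes "a \<in> bounded_operators"
  shows "cinner (a \<xi>) \<eta> = cinner \<xi> (adj a \<eta>)"
proof -
  have "\<exists>z. \<forall>\<xi>. inner (a \<xi>) \<eta> = inner z \<xi>" for \<eta>
    by (rule riesz_representation)
      (rule bounded_linear_compose [OF bounded_linear_inner_left blinfun.bounded_linear_right])
  then obtain b where b: "\<And>\<xi> \<eta>. inner (a \<xi>) \<eta> = inner (b \<eta>) \<xi>" by metis
  have "bounded_linear b"
  proof (rule bounded_linear_intro)
    show "b (x + y) = b x + b y" for x y
      by (metis b inner_add_left inner_add_right vector_eq_rdot)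
    show "b (r *\<^sub>R x) = r *\<^sub>R b x" for r x
      by (metis b inner_scaleR_left inner_scaleR_right vector_eq_rdot)
    show "norm (b x) \<le> norm x * norm a" for x
    proof -
      have "(norm (b x))\<^sup>2 = inner (a (b x)) x"
        by (simp add: b power2_norm_eq_inner)
      also have "\<dots> \<le> norm (a (b x)) * norm x" by (rule norm_cauchy_schwarz)
      also have "\<dots> \<le> (norm a * norm (b x)) * norm x"
        by (intro mult_right_mono norm_blinfun) simp
      finally have "norm (b x) * norm (b x) \<le> (norm x * norm a) * norm (b x)"
        by (simp add: power2_eq_square ac_simps)
      then show ?thesis
        by (cases "b x = 0") (auto dest: mult_right_le_imp_le)
    qed
  qed
  then have bB: "blinfun_apply (Blinfun b) = b" by (rule bounded_linear_Blinfun_apply)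
  have "cinner (a \<xi>) \<eta> = cinner \<xi> (b \<eta>)" for \<xi> \<eta>
  proof (rule complex_eqI)
    show "Re (cinner (a \<xi>) \<eta>) = Re (cinner \<xi> (b \<eta>))"
      by (simp add: Re_cinner b inner_commute [of \<xi>])
    have "(- \<i>) *\<^sub>C a \<xi> = a ((- \<i>) *\<^sub>C \<xi>)"
      using assms by (simp add: bounded_operators_def del: cvec.scale_minus_left)
    then show "Im (cinner (a \<xi>) \<eta>) = Im (cinner \<xi> (b \<eta>))"
      by (metis Im_cinner b inner_commute)
  qed
  then have "\<forall>\<xi> \<eta>. cinner (a \<xi>) \<eta> = cinner \<xi> (Blinfun b \<eta>)" by (simp add: bB)
  with adj_unique [OF this] show ?thesis by simp
qed

definition star_homomorphism ::
  "('a::complex_hilbert \<Rightarrow>\<^sub>L 'a) set \<Rightarrow> ('b::complex_hilbert \<Rightarrow>\<^sub>L 'b) set \<Rightarrow>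
    (('a \<Rightarrow>\<^sub>L 'a) \<Rightarrow> 'b \<Rightarrow>\<^sub>L 'b) \<Rightarrow> bool" where
  "star_homomorphism A B \<Phi> \<longleftrightarrow>
    (\<forall>a\<in>A. \<Phi> a \<in> B) \<and>
    (\<forall>a\<in>A. \<forall>b\<in>A. \<Phi> (a + b) = \<Phi> a + \<Phi> b) \<and>
    (\<forall>c. \<forall>a\<in>A. \<Phi> (c *\<^sub>C a) = c *\<^sub>C \<Phi> a) \<and>
    (\<forall>a\<in>A. \<forall>b\<in>A. \<Phi> (a o\<^sub>L b) = \<Phi> a o\<^sub>L \<Phi> b) \<and>
    (\<forall>a\<in>A. \<Phi> (adj a) = adj (\<Phi> a))"

definition strongly_continuous ::
  "('a::complex_hilbert \<Rightarrow>\<^sub>L 'a) set \<Rightarrow> ('b::complex_hilbert \<Rightarrow>\<^sub>L 'b) set \<Rightarrow>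
    (('a \<Rightarrow>\<^sub>L 'a) \<Rightarrow> 'b \<Rightarrow>\<^sub>L 'b) \<Rightarrow> bool" where
  "strongly_continuous A B \<Phi> \<longleftrightarrow>
    continuous_map (subtopology strong_operator_topology A)
      (subtopology strong_operator_topology B) \<Phi>"

definition compact_preserving ::
  "('a::complex_hilbert \<Rightarrow>\<^sub>L 'a) set \<Rightarrow> (('a \<Rightarrow>\<^sub>L 'a) \<Rightarrow> 'b::complex_hilbert \<Rightarrow>\<^sub>L 'b) \<Rightarrow> bool" where
  "compact_preserving A \<Phi> \<longleftrightarrow> (\<forall>a\<in>A. compact_operator a \<longrightarrow> compact_operator (\<Phi> a))"


section \<open>Square-summable functions\<close>

typedef (overloaded) ('x, 'h::real_normed_vector) ell2 =
  "{f :: 'x \<Rightarrow> 'h. (\<lambda>x. (norm (f x))\<^sup>2) summable_on UNIV}"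
  morphisms ell2_apply Abs_ell2
  by (rule exI [of _ "\<lambda>_. 0"]) simp

setup_lifting type_definition_ell2

lemma ell2_apply_summable: "(\<lambda>x. (norm (ell2_apply f x))\<^sup>2) summable_on UNIV"
  using ell2_apply by blast

lemma ell2_add_closed:
  fixes f g :: "'x \<Rightarrow> 'h::real_normed_vector"
  assumes "(\<lambda>x. (norm (f x))\<^sup>2) summable_on UNIV" "(\<lambda>x. (norm (g x))\<^sup>2) summable_on UNIV"
  shows "(\<lambda>x. (norm (f x + g x))\<^sup>2) summable_on UNIV"
proof (rule summable_on_comparison_test)
  show "(\<lambda>x. 2 * (norm (f x))\<^sup>2 + 2 * (norm (g x))\<^sup>2) summable_on UNIV"
    by (intro summable_on_add summable_on_cmult_right assms)
  fix x
  have "(norm (f x + g x))\<^sup>2 \<le> (norm (f x) + norm (g x))\<^sup>2"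
    by (intro power_mono norm_triangle_ineq) simp
  also have "\<dots> \<le> 2 * (norm (f x))\<^sup>2 + 2 * (norm (g x))\<^sup>2"
    using sum_squares_bound [of "norm (f x)" "norm (g x)"] by (simp add: power2_sum)
  finally show "(norm (f x + g x))\<^sup>2 \<le> 2 * (norm (f x))\<^sup>2 + 2 * (norm (g x))\<^sup>2" .
qed simp

instantiation ell2 :: (type, real_normed_vector) real_vector
begin

lift_definition zero_ell2 :: "('a, 'b) ell2" is "\<lambda>_. 0" by simp

lift_definition plus_ell2 :: "('a, 'b) ell2 \<Rightarrow> ('a, 'b) ell2 \<Rightarrow> ('a, 'b) ell2"
  is "\<lambda>f g x. f x + g x" by (rule ell2_add_closed)

lift_definition uminus_ell2 :: "('a, 'b) ell2 \<Rightarrow> ('a, 'b) ell2" is "\<lambda>f x. - f x" by simp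

lift_definition minus_ell2 :: "('a, 'b) ell2 \<Rightarrow> ('a, 'b) ell2 \<Rightarrow> ('a, 'b) ell2"
  is "\<lambda>f g x. f x - g x"
  subgoal for f g using ell2_add_closed [of f "\<lambda>x. - g x"] by simp
  done

lift_definition scaleR_ell2 :: "real \<Rightarrow> ('a, 'b) ell2 \<Rightarrow> ('a, 'b) ell2"
  is "\<lambda>r f x. r *\<^sub>R f x"
  by (simp add: power_mult_distrib summable_on_cmult_right)

instance
  by intro_classes (transfer; simp add: fun_eq_iff algebra_simps)+

end

lemma inner_summable:
  fixes f g :: "'x \<Rightarrow> 'h::real_inner"
  assumes "(\<lambda>x. (norm (f x))\<^sup>2) summable_on UNIV" "(\<lambda>x. (norm (g x))\<^sup>2) summable_on UNIV"
  shows "(\<lambda>x. inner (f x) (g x)) summable_on UNIV"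
proof -
  have "(\<lambda>x. ((norm (f x + g x))\<^sup>2 + (- 1) * (norm (f x))\<^sup>2 + (- 1) * (norm (g x))\<^sup>2) * (1/2)) summable_on UNIV"
    by (intro summable_on_cmult_left summable_on_cmult_right summable_on_add ell2_add_closed assms)
  moreover have "((norm (f x + g x))\<^sup>2 + (- 1) * (norm (f x))\<^sup>2 + (- 1) * (norm (g x))\<^sup>2) * (1/2)
      = inner (f x) (g x)" for x
    by (simp add: power2_norm_eq_inner inner_add_left inner_add_right inner_commute)
  ultimately show ?thesis by simp
qed

instantiation ell2 :: (type, real_inner) real_inner
begin

lift_definition inner_ell2 :: "('a, 'b) ell2 \<Rightarrow> ('a, 'b) ell2 \<Rightarrow> real"
  is "\<lambda>f g. \<Sum>\<^sub>\<infinity>x. inner (f x) (g x)" .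

definition norm_ell2 :: "('a, 'b) ell2 \<Rightarrow> real" where
  "norm_ell2 f = sqrt (inner f f)"

definition dist_ell2 :: "('a, 'b) ell2 \<Rightarrow> ('a, 'b) ell2 \<Rightarrow> real" where
  "dist_ell2 f g = norm (f - g)"

definition sgn_ell2 :: "('a, 'b) ell2 \<Rightarrow> ('a, 'b) ell2" where
  "sgn_ell2 f = f /\<^sub>R norm f"

definition uniformity_ell2 :: "(('a, 'b) ell2 \<times> ('a, 'b) ell2) filter" where
  "uniformity_ell2 = (INF e\<in>{0<..}. principal {(f, g). dist f g < e})"

definition open_ell2 :: "('a, 'b) ell2 set \<Rightarrow> bool" where
  "open_ell2 U \<longleftrightarrow> (\<forall>f\<in>U. eventually (\<lambda>(f', g). f' = f \<longrightarrow> g \<in> U) uniformity)"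

instance
proof
  fix f g h :: "('a, 'b) ell2" and r :: real
  show "inner f g = inner g f"
    by transfer (simp add: inner_commute)
  show "inner (f + g) h = inner f h + inner g h"
    by transfer (simp add: inner_add_left infsum_add inner_summable)
  show "inner (r *\<^sub>R f) g = r * inner f g"
    by transfer (simp add: infsum_cmult_right')
  show "0 \<le> inner f f"
    by transfer (simp add: infsum_nonneg)
  show "inner f f = 0 \<longleftrightarrow> f = 0"
  proof transfer
    fix f :: "'a \<Rightarrow> 'b" assume f: "(\<lambda>x. (norm (f x))\<^sup>2) summable_on UNIV"
    show "(\<Sum>\<^sub>\<infinity>x. inner (f x) (f x)) = 0 \<longleftrightarrow> f = (\<lambda>_. 0)"
    proof
      assume "(\<Sum>\<^sub>\<infinity>x. inner (f x) (f x)) = 0"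
      then have "inner (f x) (f x) = 0" for x
        by (intro nonneg_infsum_le_0D [where A = UNIV and f = "\<lambda>x. inner (f x) (f x)"])
          (auto intro: inner_summable f)
      then show "f = (\<lambda>_. 0)" by auto
    qed simp
  qed
qed (simp_all add: norm_ell2_def dist_ell2_def sgn_ell2_def uniformity_ell2_def open_ell2_def)

end

lemma norm_ell2_squared: "(norm f)\<^sup>2 = (\<Sum>\<^sub>\<infinity>x. (norm (ell2_apply f x))\<^sup>2)"
  unfolding power2_norm_eq_inner by transfer simp

lemma ell2_apply_simps [simp]:
  "ell2_apply 0 x = 0"
  "ell2_apply (f + g) x = ell2_apply f x + ell2_apply g x"
  "ell2_apply (f - g) x = ell2_apply f x - ell2_apply g x"
  "ell2_apply (- f) x = - ell2_apply f x"
  "ell2_apply (r *\<^sub>R f) x = r *\<^sub>R ell2_apply f x"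
  by (transfer; simp)+

lemma sum_norm_ell2_le:
  fixes f :: "('x, 'h::real_inner) ell2"
  assumes "finite F"
  shows "(\<Sum>x\<in>F. (norm (ell2_apply f x))\<^sup>2) \<le> (norm f)\<^sup>2"
  unfolding norm_ell2_squared
  by (rule finite_sum_le_infsum) (auto intro: ell2_apply_summable assms)

lemma norm_ell2_apply_le: "norm (ell2_apply f x) \<le> norm (f :: ('x, 'h::real_inner) ell2)"
  using sum_norm_ell2_le [of "{x}" f] power2_le_imp_le [OF _ norm_ge_zero] by simp

instance ell2 :: (type, "{real_inner, complete_space}") complete_space
proof
  fix X :: "nat \<Rightarrow> ('a, 'b) ell2"
  assume "Cauchy X"
  have "Cauchy (\<lambda>n. ell2_apply (X n) x)" for x
  proof (rule metric_CauchyI)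
    fix e :: real assume "e > 0"
    then obtain N where "\<forall>m\<ge>N. \<forall>n\<ge>N. dist (X m) (X n) < e"
      using \<open>Cauchy X\<close> metric_CauchyD by blast
    moreover have "dist (ell2_apply (X m) x) (ell2_apply (X n) x) \<le> dist (X m) (X n)" for m n
      using norm_ell2_apply_le [of "X m - X n" x] by (simp add: dist_norm)
    ultimately show "\<exists>M. \<forall>m\<ge>M. \<forall>n\<ge>M. dist (ell2_apply (X m) x) (ell2_apply (X n) x) < e"
      by (meson le_less_trans)
  qed
  then have "\<exists>l. (\<lambda>n. ell2_apply (X n) x) \<longlonglongrightarrow> l" for x
    using Cauchy_convergent convergent_def by blast
  then obtain g where g: "\<And>x. (\<lambda>n. ell2_apply (X n) x) \<longlonglongrightarrow> g x" by metis
  have bound: "(\<Sum>x\<in>F. (norm (g x - ell2_apply (X m) x))\<^sup>2) \<le> e\<^sup>2"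
    if "\<forall>n\<ge>N. dist (X m) (X n) < e" "finite F" "e > 0" for m N e F
  proof (rule LIMSEQ_le_const2)
    show "(\<lambda>n. \<Sum>x\<in>F. (norm (ell2_apply (X n) x - ell2_apply (X m) x))\<^sup>2)
        \<longlonglongrightarrow> (\<Sum>x\<in>F. (norm (g x - ell2_apply (X m) x))\<^sup>2)"
      by (intro tendsto_intros g)
    have "(\<Sum>x\<in>F. (norm (ell2_apply (X n) x - ell2_apply (X m) x))\<^sup>2) \<le> e\<^sup>2" if "n \<ge> N" for n
    proof -
      have "(\<Sum>x\<in>F. (norm (ell2_apply (X n - X m) x))\<^sup>2) \<le> (norm (X n - X m))\<^sup>2"
        using \<open>finite F\<close> by (rule sum_norm_ell2_le)
      also have "(norm (X n - X m))\<^sup>2 \<le> e\<^sup>2"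
      proof (rule power_mono)
        have "dist (X m) (X n) < e"
          using \<open>\<forall>n\<ge>N. dist (X m) (X n) < e\<close> \<open>n \<ge> N\<close> by blast
        then show "norm (X n - X m) \<le> e"
          by (simp add: dist_norm norm_minus_commute)
      qed simp
      finally show ?thesis by simp
    qed
    then show "\<exists>N. \<forall>n\<ge>N. (\<Sum>x\<in>F. (norm (ell2_apply (X n) x - ell2_apply (X m) x))\<^sup>2) \<le> e\<^sup>2"
      by blast
  qed
  have summ: "(\<lambda>x. (norm (g x - ell2_apply (X m) x))\<^sup>2) summable_on UNIV"
    if "\<forall>n\<ge>N. dist (X m) (X n) < e" "e > 0" for m N e
  proof (rule nonneg_bounded_partial_sums_imp_summable_on)
    show "eventually (\<lambda>F. (\<Sum>x\<in>F. (norm (g x - ell2_apply (X m) x))\<^sup>2) \<le> e\<^sup>2)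
        (finite_subsets_at_top UNIV)"
      by (rule eventually_finite_subsets_at_top_weakI) (rule bound [OF that(1) _ that(2)])
  qed simp
  obtain N1 where N1: "\<forall>m\<ge>N1. \<forall>n\<ge>N1. dist (X m) (X n) < 1"
    using \<open>Cauchy X\<close> metric_CauchyD [of X 1] by auto
  have "(\<lambda>x. (norm (g x))\<^sup>2) summable_on UNIV"
  proof -
    have "\<forall>n\<ge>N1. dist (X N1) (X n) < 1" using N1 by blast
    from ell2_add_closed [OF summ [OF this zero_less_one] ell2_apply_summable [of "X N1"]]
    show ?thesis by simp
  qed
  then obtain G where G: "ell2_apply G = g"
    using Abs_ell2_inverse by (metis mem_Collect_eq)
  have "X \<longlonglongrightarrow> G"
  proof (rule metric_LIMSEQ_I)
    fix e :: real assume "e > 0"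
    then have e2: "e / 2 > 0" by simp
    then obtain N where N: "\<forall>m\<ge>N. \<forall>n\<ge>N. dist (X m) (X n) < e / 2"
      using \<open>Cauchy X\<close> metric_CauchyD by blast
    have "dist (X m) G < e" if "m \<ge> N" for m
    proof -
      have "(norm (G - X m))\<^sup>2 \<le> (e / 2)\<^sup>2"
        unfolding norm_ell2_squared
      proof (rule infsum_le_finite_sums)
        have m: "\<forall>n\<ge>N. dist (X m) (X n) < e / 2" using N \<open>m \<ge> N\<close> by blast
        show "(\<lambda>x. (norm (ell2_apply (G - X m) x))\<^sup>2) summable_on UNIV"
          by (rule ell2_apply_summable)
        show "(\<Sum>x\<in>F. (norm (ell2_apply (G - X m) x))\<^sup>2) \<le> (e / 2)\<^sup>2" if "finite F" for F
          using bound [OF m that e2] by (simp only: ell2_apply_simps G)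
      qed
      then have "norm (G - X m) \<le> e / 2"
        using e2 by (meson less_imp_le power2_le_imp_le)
      then show ?thesis using \<open>e > 0\<close> by (simp add: dist_norm norm_minus_commute)
    qed
    then show "\<exists>N. \<forall>n\<ge>N. dist (X n) G < e" by blast
  qed
  then show "convergent X" by (rule convergentI)
qed

lemma cinner_summable:
  fixes f g :: "'x \<Rightarrow> 'h::complex_inner"
  assumes "(\<lambda>x. (norm (f x))\<^sup>2) summable_on UNIV" "(\<lambda>x. (norm (g x))\<^sup>2) summable_on UNIV"
  shows "(\<lambda>x. cinner (f x) (g x)) summable_on UNIV"
proof -
  have "(\<lambda>x. (norm ((- \<i>) *\<^sub>C f x))\<^sup>2) summable_on UNIV"
    using assms(1) by (simp add: norm_scaleC del: cvec.scale_minus_left)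
  then have "(\<lambda>x. complex_of_real (inner (f x) (g x))
      + \<i> * complex_of_real (inner ((- \<i>) *\<^sub>C f x) (g x))) summable_on UNIV"
    by (intro summable_on_add summable_on_cmult_right summable_on_of_real inner_summable assms)
  moreover have "complex_of_real (inner (f x) (g x))
      + \<i> * complex_of_real (inner ((- \<i>) *\<^sub>C f x) (g x)) = cinner (f x) (g x)" for x
    by (rule complex_eqI) (simp_all add: Re_cinner Im_cinner)
  ultimately show ?thesis by simp
qed

instantiation ell2 :: (type, complex_inner) complex_inner
begin

lift_definition scaleC_ell2 :: "complex \<Rightarrow> ('a, 'b) ell2 \<Rightarrow> ('a, 'b) ell2"
  is "\<lambda>c f x. c *\<^sub>C f x"
  by (simp add: norm_scaleC power_mult_distrib summable_on_cmult_right)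

lift_definition cinner_ell2 :: "('a, 'b) ell2 \<Rightarrow> ('a, 'b) ell2 \<Rightarrow> complex"
  is "\<lambda>f g. \<Sum>\<^sub>\<infinity>x. cinner (f x) (g x)" .

instance
proof
  fix f g h :: "('a, 'b) ell2" and b c :: complex and r :: real
  show "c *\<^sub>C (f + g) = c *\<^sub>C f + c *\<^sub>C g" by transfer (simp add: scaleC_add_right)
  show "(b + c) *\<^sub>C f = b *\<^sub>C f + c *\<^sub>C f" by transfer (simp add: scaleC_add_left)
  show "b *\<^sub>C c *\<^sub>C f = (b * c) *\<^sub>C f" by transfer simp
  show "1 *\<^sub>C f = f" by transfer simp
  show "r *\<^sub>R f = complex_of_real r *\<^sub>C f" by transfer (simp add: scaleR_scaleC)
  show "cinner f g = cnj (cinner g f)"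
    by transfer (subst infsum_cnj [symmetric], subst cinner_commute, rule refl)
  show "cinner (f + g) h = cinner f h + cinner g h"
    by transfer (simp add: cinner_add_left infsum_add cinner_summable)
  show "cinner (c *\<^sub>C f) g = c * cinner f g"
    by transfer (simp add: cinner_scaleC_left infsum_cmult_right')
  show "Re (cinner f g) = inner f g"
    by transfer (simp add: infsum_Re [symmetric] cinner_summable Re_cinner)
qed

end

instance ell2 :: (type, complex_hilbert) complex_hilbert ..

lemma ell2_apply_scaleC [simp]: "ell2_apply (c *\<^sub>C f) x = c *\<^sub>C ell2_apply f x"
  by transfer simp

text \<open>\<open>delta x \<eta>\<close> is the function \<open>\<delta>\<^sub>x \<otimes> \<eta>\<close>.\<close>

lift_definition delta :: "'x \<Rightarrow> 'h::real_normed_vector \<Rightarrow> ('x, 'h) ell2"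
  is "\<lambda>x \<eta> z. if z = x then \<eta> else 0"
  subgoal for x \<eta> by (rule finite_nonzero_values_imp_summable_on) (auto intro: finite_subset [of _ "{x}"])
  done

lemma ell2_apply_delta: "ell2_apply (delta x \<eta>) z = (if z = x then \<eta> else 0)"
  by transfer simp

lemma cinner_delta_right:
  fixes f :: "('x, 'h::complex_inner) ell2"
  shows "cinner f (delta y \<eta>) = cinner (ell2_apply f y) \<eta>"
proof transfer
  fix f :: "'x \<Rightarrow> 'h" and y \<eta>
  have "(\<Sum>\<^sub>\<infinity>x. cinner (f x) (if x = y then \<eta> else 0))
      = (\<Sum>\<^sub>\<infinity>x\<in>{y}. cinner (f x) (if x = y then \<eta> else 0))"
    by (rule infsum_cong_neutral) (auto simp: cinner_commute [of _ 0])
  then show "(\<Sum>\<^sub>\<infinity>x. cinner (f x) (if x = y then \<eta> else 0)) = cinner (f y) \<eta>" by simp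
qed


section \<open>Band-dominated operators\<close>

text \<open>Since \<^const>\<open>card\<close> vanishes on infinite sets, finiteness of the balls is required separately.\<close>

definition uniformly_locally_finite :: "'x::metric_space set \<Rightarrow> bool" where
  "uniformly_locally_finite X \<longleftrightarrow>
    (\<forall>r>0. \<exists>N::nat. \<forall>x\<in>X. finite (X \<inter> cball x r) \<and> card (X \<inter> cball x r) \<le> N)"

text \<open>The matrix entry \<open>a\<^sub>x\<^sub>y\<close>; note that it maps the fibre at \<open>x\<close> to the fibre at \<open>y\<close>.\<close>

definition entry ::
  "(('x, 'h::complex_hilbert) ell2 \<Rightarrow>\<^sub>L ('x, 'h) ell2) \<Rightarrow> 'x \<Rightarrow> 'x \<Rightarrow> 'h \<Rightarrow>\<^sub>L 'h" where
  "entry a x y = (THE b :: 'h \<Rightarrow>\<^sub>L 'h. \<forall>\<xi> \<eta>. cinner (b \<xi>) \<eta> = cinner (a (delta x \<xi>)) (delta y \<eta>))"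

lemma blinfun_apply_entry:
  fixes a :: "('x, 'h::complex_hilbert) ell2 \<Rightarrow>\<^sub>L ('x, 'h) ell2"
  shows "entry a x y \<xi> = ell2_apply (a (delta x \<xi>)) y"
proof -
  let ?b = "\<lambda>\<xi>. ell2_apply (a (delta x \<xi>)) y"
  have "bounded_linear ?b"
  proof (rule bounded_linear_intro)
    show "?b (\<xi> + \<eta>) = ?b \<xi> + ?b \<eta>" for \<xi> \<eta>
    proof -
      have "delta x (\<xi> + \<eta>) = delta x \<xi> + delta x \<eta>" by transfer auto
      then show ?thesis by (simp add: blinfun.add_right)
    qed
    show "?b (r *\<^sub>R \<xi>) = r *\<^sub>R ?b \<xi>" for r \<xi>
    proof -
      have "delta x (r *\<^sub>R \<xi>) = r *\<^sub>R delta x \<xi>" by transfer auto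
      then show ?thesis by (simp add: blinfun.scaleR_right)
    qed
    show "norm (?b \<xi>) \<le> norm \<xi> * norm a" for \<xi>
    proof -
      have "(norm (delta x \<xi>))\<^sup>2 = (norm \<xi>)\<^sup>2"
        unfolding power2_norm_eq_inner Re_cinner [symmetric] cinner_delta_right
        by (simp add: ell2_apply_delta)
      then have "norm (delta x \<xi>) = norm \<xi>" by simp
      then show ?thesis
        using norm_ell2_apply_le [of "a (delta x \<xi>)" y] norm_blinfun [of a "delta x \<xi>"]
        by (simp add: mult.commute)
    qed
  qed
  then have b: "blinfun_apply (Blinfun ?b) = ?b" by (rule bounded_linear_Blinfun_apply)
  have "entry a x y = Blinfun ?b"
    unfolding entry_def cinner_delta_right
  proof (rule the_equality)
    fix b' :: "'h \<Rightarrow>\<^sub>L 'h" assume "\<forall>\<xi> \<eta>. cinner (b' \<xi>) \<eta> = cinner (?b \<xi>) \<eta>"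
    then show "b' = Blinfun ?b" by (intro blinfun_eqI) (simp add: b cinner_eq_iff)
  qed (simp add: b)
  then show ?thesis by (simp add: b)
qed

text \<open>The supremum is taken in \<open>[0, \<infinity>]\<close>, so that \<open>propagation 0 = 0\<close>.\<close>

definition propagation ::
  "(('x::metric_space, 'h::complex_hilbert) ell2 \<Rightarrow>\<^sub>L ('x, 'h) ell2) \<Rightarrow> ennreal" where
  "propagation a = Sup {ennreal (dist x y) | x y. entry a x y \<noteq> 0}"

definition BD :: "(('x::metric_space, 'h::complex_hilbert) ell2 \<Rightarrow>\<^sub>L ('x, 'h) ell2) set" where
  "BD = closure {a \<in> bounded_operators. propagation a < \<infinity>}"

definition coarse_like ::
  "((('x::metric_space, 'h::complex_hilbert) ell2 \<Rightarrow>\<^sub>L ('x, 'h) ell2) \<Rightarrow>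
    ('y::metric_space, 'h) ell2 \<Rightarrow>\<^sub>L ('y, 'h) ell2) \<Rightarrow> bool" where
  "coarse_like \<Phi> \<longleftrightarrow>
    (\<forall>\<epsilon>>0. \<forall>r>0. \<exists>s>0. \<forall>a\<in>BD. norm a \<le> 1 \<and> propagation a \<le> ennreal r \<longrightarrow>
      (\<exists>c\<in>BD. propagation c \<le> ennreal s \<and> norm (\<Phi> a - c) \<le> \<epsilon>))"

end

theory Submission
  imports Defs
begin

text \<open>The infinite multiplicity of the fibre \<open>H\<close> makes the uniformity automatic. Since \<open>H\<close> has an
  infinite countable orthonormal basis, there are isometries \<open>v\<^sub>k\<close> of \<open>H\<close> with pairwise orthogonal
  ranges: let \<open>v\<^sub>k\<close> send the \<open>n\<close>-th basis vector to the one with number \<open>\<langle>k, n\<rangle>\<close>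
  (\<open>orthogonal_isometries_exist\<close>). Acting with \<open>v\<^sub>k\<close> in every fibre gives isometries \<open>V\<^sub>k\<close> of
  \<open>\<ell>\<^sub>2(X, H)\<close> of propagation zero (\<open>amplified_isometries_exist\<close>). Any sequence of contractions
  \<open>a\<^sub>k\<close> of propagation at most \<open>r\<close> can then be stored in the single operator
  \<open>A = \<Sum>\<^sub>k V\<^sub>k a\<^sub>k V\<^sub>k\<^sup>*\<close>, again of propagation at most \<open>r\<close>, and recovered as
  \<open>a\<^sub>k = V\<^sub>k\<^sup>* A V\<^sub>k\<close> (\<open>block_diagonal_operator\<close>).

  Suppose that coarse-likeness fails for \<open>\<epsilon>\<close> and \<open>r\<close>. The operators \<open>\<Phi>(V\<^sub>k)\<close> and \<open>\<Phi>(V\<^sub>k\<^sup>*)\<close> are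
  contractions in \<open>BD(Y)\<close>, so there are \<open>d\<^sub>k\<close> and \<open>e\<^sub>k\<close> within \<open>1/(k+1)\<close> of them whose propagations
  are finite, say at most \<open>t\<^sub>k\<close> and \<open>t'\<^sub>k\<close>. These bounds may grow with \<open>k\<close> in an uncontrolled way, but
  they are known before the \<open>a\<^sub>k\<close> have to be chosen: let \<open>a\<^sub>k\<close> be a counterexample for the
  propagation bound \<open>t'\<^sub>k + (k+1) + t\<^sub>k\<close>. Now \<open>\<Phi>(A)\<close> is one element of \<open>BD(Y)\<close>, hence within
  \<open>\<epsilon>/2\<close> of some \<open>c\<close> of finite propagation. As
  \<open>\<Phi>(a\<^sub>k) = \<Phi>(V\<^sub>k\<^sup>*) \<Phi>(A) \<Phi>(V\<^sub>k)\<close>, the product \<open>e\<^sub>k c d\<^sub>k\<close> is within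
  \<open>\<epsilon>/2 + 3\<parallel>c\<parallel>/(k+1)\<close> of \<open>\<Phi>(a\<^sub>k)\<close> and has propagation at most
  \<open>t'\<^sub>k + prop(c) + t\<^sub>k\<close> (\<open>propagation_compose_le\<close>). For large \<open>k\<close> this contradicts the choice
  of \<open>a\<^sub>k\<close>.\<close>


section \<open>Orthogonal series\<close>

lemma norm_sum_orthogonal:
  fixes u :: "'i \<Rightarrow> 'a::real_inner"
  assumes "finite F" and "\<And>i j. i \<noteq> j \<Longrightarrow> inner (u i) (u j) = 0"
  shows "(norm (\<Sum>i\<in>F. u i))\<^sup>2 = (\<Sum>i\<in>F. (norm (u i))\<^sup>2)"
proof -
  have "inner (\<Sum>i\<in>F. u i) (\<Sum>i\<in>F. u i) = (\<Sum>i\<in>F. \<Sum>j\<in>F. inner (u i) (u j))"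
    unfolding inner_sum_left inner_sum_right by (rule sum.swap)
  also have "\<dots> = (\<Sum>i\<in>F. inner (u i) (u i))"
  proof (rule sum.cong)
    fix i assume "i \<in> F"
    then have "(\<Sum>j\<in>F. inner (u i) (u j)) = (\<Sum>j\<in>{i}. inner (u i) (u j))"
      using assms(1) by (intro sum.mono_neutral_right) (auto intro: assms(2))
    then show "(\<Sum>j\<in>F. inner (u i) (u j)) = inner (u i) (u i)" by simp
  qed simp
  finally show ?thesis by (simp add: power2_norm_eq_inner)
qed

lemma orthogonal_series:
  fixes u :: "nat \<Rightarrow> 'a::{real_inner, complete_space}"
  assumes orth: "\<And>i j. i \<noteq> j \<Longrightarrow> inner (u i) (u j) = 0"
    and sq: "summable (\<lambda>n. (norm (u n))\<^sup>2)"
  shows "summable u" and "(norm (suminf u))\<^sup>2 = (\<Sum>n. (norm (u n))\<^sup>2)"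
proof -
  have "Cauchy (\<lambda>n. sum u {..<n})"
  proof (rule CauchyI)
    fix e :: real assume e: "e > 0"
    then have "e\<^sup>2 > 0" by simp
    then obtain N where N: "\<And>m n. m \<ge> N \<Longrightarrow> norm (\<Sum>k = m..<n. (norm (u k))\<^sup>2) < e\<^sup>2"
      using sq unfolding summable_Cauchy by blast
    have tail: "norm (sum u {..<n} - sum u {..<m}) < e" if "N \<le> m" "m \<le> n" for m n
    proof -
      have eq: "sum u {..<n} - sum u {..<m} = sum u {m..<n}"
        using that sum_diff_nat_ivl [of 0 m n u] by (simp add: atLeast0LessThan)
      have "(norm (sum u {m..<n}))\<^sup>2 < e\<^sup>2"
        using N [OF that(1), of n] norm_sum_orthogonal [of "{m..<n}" u] orth
        by (simp add: sum_nonneg)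
      then show ?thesis
        unfolding eq using less_imp_le [OF e] by (rule power_less_imp_less_base)
    qed
    have "norm (sum u {..<m} - sum u {..<n}) < e" if "N \<le> m" "N \<le> n" for m n
      using tail [of m n] tail [of n m] that by (cases "m \<le> n") (auto simp: norm_minus_commute)
    then show "\<exists>M. \<forall>m\<ge>M. \<forall>n\<ge>M. norm (sum u {..<m} - sum u {..<n}) < e" by blast
  qed
  then show summ: "summable u"
    by (simp add: summable_iff_convergent Cauchy_convergent_iff)
  have "(\<lambda>n. (norm (sum u {..<n}))\<^sup>2) \<longlonglongrightarrow> (norm (suminf u))\<^sup>2"
    by (intro tendsto_intros summable_LIMSEQ summ)
  moreover have "(\<lambda>n. (norm (sum u {..<n}))\<^sup>2) \<longlonglongrightarrow> (\<Sum>n. (norm (u n))\<^sup>2)"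
    using summable_LIMSEQ [OF sq] norm_sum_orthogonal [of _ u] orth by simp
  ultimately show "(norm (suminf u))\<^sup>2 = (\<Sum>n. (norm (u n))\<^sup>2)"
    by (rule LIMSEQ_unique)
qed

text \<open>The hypothesis on \<open>inner f (u i)\<close> says that \<open>u i\<close> is the orthogonal projection of \<open>f\<close> onto the
  line through \<open>u i\<close>. This covers the expansion of a vector in an orthonormal sequence as well as
  its components in orthogonal closed subspaces.\<close>

lemma bessel:
  fixes u :: "nat \<Rightarrow> 'a::real_inner"
  assumes orth: "\<And>i j. i \<noteq> j \<Longrightarrow> inner (u i) (u j) = 0"
    and proj: "\<And>i. inner f (u i) = (norm (u i))\<^sup>2"
  shows "summable (\<lambda>n. (norm (u n))\<^sup>2)" and "(\<Sum>n. (norm (u n))\<^sup>2) \<le> (norm f)\<^sup>2"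
proof -
  have partial: "(\<Sum>k<n. (norm (u k))\<^sup>2) \<le> (norm f)\<^sup>2" for n
  proof -
    have 1: "inner f (\<Sum>k<n. u k) = (\<Sum>k<n. (norm (u k))\<^sup>2)"
      by (simp add: inner_sum_right proj)
    have 2: "inner (\<Sum>k<n. u k) (\<Sum>k<n. u k) = (\<Sum>k<n. (norm (u k))\<^sup>2)"
      using norm_sum_orthogonal [of "{..<n}" u] orth by (simp add: power2_norm_eq_inner)
    have "0 \<le> inner (f - (\<Sum>k<n. u k)) (f - (\<Sum>k<n. u k))" by simp
    also have "\<dots> = (norm f)\<^sup>2 - (\<Sum>k<n. (norm (u k))\<^sup>2)"
      using 1 2 inner_commute [of "\<Sum>k<n. u k" f]
      by (simp only: inner_diff_left inner_diff_right power2_norm_eq_inner [of f])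
    finally show ?thesis by simp
  qed
  show summ: "summable (\<lambda>n. (norm (u n))\<^sup>2)"
    by (rule summableI_nonneg_bounded [OF _ partial]) simp
  show "(\<Sum>n. (norm (u n))\<^sup>2) \<le> (norm f)\<^sup>2"
    by (rule suminf_le_const [OF summ partial])
qed


section \<open>Orthonormal bases and isometries with orthogonal ranges\<close>

lemma cinner_minus_left [simp]: "cinner (- x) y = - cinner x y"
  using cinner_add_left [of "- x" x y] by (simp add: eq_neg_iff_add_eq_0)

lemma cinner_diff_left: "cinner (x - y) z = cinner x z - cinner y z"
  using cinner_add_left [of x "- y" z] by simp

lemma cinner_self: "cinner x x = complex_of_real ((norm x)\<^sup>2)"
proof -
  have "Im (cinner x x) = 0"
    using cinner_commute [of x x] by (metis Reals_cnj_iff complex_is_Real_iff)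
  then show ?thesis by (simp add: complex_eq_iff Re_cinner power2_norm_eq_inner)
qed

lemma norm_eq_1_cinner: "norm x = 1" if "cinner x x = 1"
proof (rule power2_eq_imp_eq)
  have "complex_of_real ((norm x)\<^sup>2) = 1" using that by (simp only: cinner_self)
  then show "(norm x)\<^sup>2 = 1\<^sup>2" by (metis of_real_eq_1_iff one_power2)
qed simp_all

lemma cinner_all_eq_0: "x = 0" if "\<And>y. cinner x y = 0"
  using that [of x] by (simp add: cinner_self)

lemma cinner_zero_right [simp]: "cinner x 0 = 0"
  using cinner_add_right [of x 0 0] by simp

lemma bounded_linear_cinner_left: "bounded_linear (\<lambda>x :: 'a::complex_inner. cinner x y)"
proof (rule bounded_linear_intro)
  show "cinner (r *\<^sub>R x) y = r *\<^sub>R cinner x y" for r x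
    by (simp add: scaleR_scaleC cinner_scaleC_left scaleC_complex_def)
  show "cmod (cinner x y) \<le> norm x * (2 * norm y)" for x
  proof -
    have "cmod (cinner x y) \<le> \<bar>Re (cinner x y)\<bar> + \<bar>Im (cinner x y)\<bar>" by (rule cmod_le)
    also have "\<dots> \<le> norm x * norm y + norm ((- \<i>) *\<^sub>C x) * norm y"
      unfolding Re_cinner Im_cinner by (intro add_mono Cauchy_Schwarz_ineq2)
    finally show ?thesis by (simp add: norm_scaleC del: cvec.scale_minus_left)
  qed
qed (rule cinner_add_left)

lemma cinner_sum_left: "cinner (\<Sum>i\<in>F. f i) y = (\<Sum>i\<in>F. cinner (f i) y)"
  using bounded_linear.linear [OF bounded_linear_cinner_left] by (rule linear_sum)

definition orthonormal :: "'a::complex_inner set \<Rightarrow> bool" where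
  "orthonormal B \<longleftrightarrow> (\<forall>b\<in>B. norm b = 1) \<and> (\<forall>b\<in>B. \<forall>c\<in>B. b \<noteq> c \<longrightarrow> cinner b c = 0)"

text \<open>By Zorn's lemma; a nonzero vector orthogonal to a maximal orthonormal set could be normalised
  and added to it.\<close>

lemma maximal_orthonormal_exists:
  obtains B :: "'a::complex_inner set"
  where "orthonormal B" and "\<And>\<xi>. (\<And>b. b \<in> B \<Longrightarrow> cinner \<xi> b = 0) \<Longrightarrow> \<xi> = 0"
proof -
  have "\<exists>M\<in>Collect orthonormal. \<forall>X\<in>Collect orthonormal. M \<subseteq> X \<longrightarrow> X = (M :: 'a set)"
  proof (rule subset_Zorn_nonempty)
    show "Collect orthonormal \<noteq> ({} :: 'a set set)" by (auto simp: orthonormal_def)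
    fix C :: "'a set set" assume "C \<noteq> {}" and C: "subset.chain (Collect orthonormal) C"
    have "\<exists>M\<in>C. b \<in> M \<and> c \<in> M" if bc: "b \<in> \<Union> C" "c \<in> \<Union> C" for b c
    proof -
      obtain M N where MN: "M \<in> C" "N \<in> C" "b \<in> M" "c \<in> N" using bc by blast
      then have "M \<subseteq> N \<or> N \<subseteq> M" using C by (auto simp: subset_chain_def)
      then show ?thesis using MN by blast
    qed
    moreover have "orthonormal M" if "M \<in> C" for M
      using C that by (auto simp: subset_chain_def)
    ultimately have "orthonormal (\<Union> C)"
      unfolding orthonormal_def by (metis UnionE)
    then show "\<Union> C \<in> Collect orthonormal" by simp
  qed
  then obtain M :: "'a set" where M: "orthonormal M" "\<And>X. orthonormal X \<Longrightarrow> M \<subseteq> X \<Longrightarrow> X = M"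
    by auto
  have "\<xi> = 0" if \<xi>: "\<And>b. b \<in> M \<Longrightarrow> cinner \<xi> b = 0" for \<xi>
  proof (rule ccontr)
    assume "\<xi> \<noteq> 0"
    define \<eta> where "\<eta> = complex_of_real (1 / norm \<xi>) *\<^sub>C \<xi>"
    have \<eta>: "norm \<eta> = 1" using \<open>\<xi> \<noteq> 0\<close> by (simp add: \<eta>_def norm_scaleC norm_divide)
    have left: "cinner \<eta> b = 0" if "b \<in> M" for b
      using \<xi> [OF that] by (simp add: \<eta>_def cinner_scaleC_left)
    moreover have "cinner b \<eta> = 0" if "b \<in> M" for b
      using left [OF that] cinner_commute [of b \<eta>] by simp
    ultimately have "orthonormal (insert \<eta> M)"
      using M(1) \<eta> by (simp add: orthonormal_def)
    then have "\<eta> \<in> M" using M(2) by blast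
    then have "cinner \<eta> \<eta> = 0" by (rule left)
    then show False using \<eta> by (simp add: cinner_self)
  qed
  with M(1) show ?thesis using that by blast
qed

text \<open>Distinct members have distance \<open>\<surd>2\<close>, so points of a countable dense set that are within \<open>1/2\<close>
  of them are distinct as well.\<close>

lemma countable_orthonormal:
  assumes sep: "separable_space (euclidean :: 'a::complex_inner topology)"
    and B: "orthonormal (B :: 'a set)"
  shows "countable B"
proof -
  obtain D :: "'a set" where D: "countable D" "closure D = UNIV"
    using sep by (auto simp: separable_space_def)
  have "\<exists>d\<in>D. dist d b < 1/2" for b
    using D(2) closure_approachable [of b D] by (metis UNIV_I half_gt_zero_iff zero_less_one)
  then obtain f where f: "\<And>b. f b \<in> D" "\<And>b. dist (f b) b < 1/2" by metis
  have "inj_on f B"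
  proof (rule inj_onI, rule ccontr)
    fix b c assume bc: "b \<in> B" "c \<in> B" "f b = f c" "b \<noteq> c"
    have "inner b c = 0" using B bc by (simp add: orthonormal_def Re_cinner [symmetric])
    then have "(norm (b - c))\<^sup>2 = (norm b)\<^sup>2 + (norm c)\<^sup>2"
      by (simp add: power2_norm_eq_inner inner_diff_left inner_diff_right inner_commute)
    then have "(dist b c)\<^sup>2 = 2" using B bc by (simp add: orthonormal_def dist_norm)
    moreover have "dist b c < 1"
      using f(2) [of b] f(2) [of c] bc(3) dist_triangle_half_r [of "f b" b 1 c] by simp
    then have "(dist b c)\<^sup>2 \<le> 1" by (simp add: power_le_one)
    ultimately show False by simp
  qed
  moreover have "countable (f ` B)"
    using f(1) D(1) countable_subset [of "f ` B" D] by blast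
  ultimately show ?thesis using countable_image_inj_on by blast
qed

lemma orthonormal_basis_exists:
  assumes sep: "separable_space (euclidean :: 'h::complex_hilbert topology)"
    and inf: "infinite_dimensional TYPE('h::complex_hilbert)"
  obtains e :: "nat \<Rightarrow> 'h::complex_hilbert"
  where "\<And>m n. cinner (e m) (e n) = (if m = n then 1 else 0)"
    and "\<And>\<xi>. (\<And>n. cinner \<xi> (e n) = 0) \<Longrightarrow> \<xi> = 0"
proof -
  obtain B :: "'h set" where B: "orthonormal B"
    and max: "\<And>\<xi>. (\<And>b. b \<in> B \<Longrightarrow> cinner \<xi> b = 0) \<Longrightarrow> \<xi> = 0"
    by (rule maximal_orthonormal_exists) blast
  have BB: "cinner b c = (if b = c then 1 else 0)" if "b \<in> B" "c \<in> B" for b c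
    using B that by (auto simp: orthonormal_def cinner_self)
  have "infinite B"
  proof
    assume fin: "finite B"
    have "\<xi> \<in> cvec.span B" for \<xi>
    proof -
      \<comment> \<open>By maximality, every vector equals its projection onto the span.\<close>
      define \<zeta> where "\<zeta> = (\<Sum>b\<in>B. cinner \<xi> b *\<^sub>C b)"
      have "cinner (\<xi> - \<zeta>) c = 0" if "c \<in> B" for c
      proof -
        have "cinner \<zeta> c = (\<Sum>b\<in>B. cinner \<xi> b * (if b = c then 1 else 0))"
          unfolding \<zeta>_def cinner_sum_left
          by (rule sum.cong) (simp_all add: cinner_scaleC_left BB that)
        also have "\<dots> = (\<Sum>b\<in>B. if b = c then cinner \<xi> b else 0)"
          by (rule sum.cong) simp_all
        also have "\<dots> = cinner \<xi> c" using fin that by simp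
        finally show ?thesis by (simp add: cinner_diff_left)
      qed
      then have "\<xi> = \<zeta>" using max [of "\<xi> - \<zeta>"] by simp
      also have "\<zeta> \<in> cvec.span B"
        unfolding \<zeta>_def by (intro cvec.span_sum cvec.span_scale cvec.span_base)
      finally show ?thesis .
    qed
    then show False using inf fin by (auto simp: infinite_dimensional_def)
  qed
  moreover have "countable B" using sep B by (rule countable_orthonormal)
  ultimately have bij: "bij_betw (from_nat_into B) UNIV B" by (intro bij_betw_from_nat_into)
  show ?thesis
  proof
    have mem: "from_nat_into B n \<in> B" for n using bij by (auto simp: bij_betw_def)
    show "cinner (from_nat_into B m) (from_nat_into B n) = (if m = n then 1 else 0)" for m n
      using BB [OF mem [of m] mem [of n]] bij_betw_imp_inj_on [OF bij] by (auto dest: injD)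
    show "\<xi> = 0" if "\<And>n. cinner \<xi> (from_nat_into B n) = 0" for \<xi>
      using max that bij by (metis bij_betw_imp_surj_on imageE)
  qed
qed

lemma parseval:
  fixes e :: "nat \<Rightarrow> 'h::complex_hilbert"
  assumes e: "\<And>m n. cinner (e m) (e n) = (if m = n then 1 else 0)"
    and max: "\<And>\<xi>. (\<And>n. cinner \<xi> (e n) = 0) \<Longrightarrow> \<xi> = 0"
  shows "(\<lambda>n. (cmod (cinner \<xi> (e n)))\<^sup>2) sums (norm \<xi>)\<^sup>2"
proof -
  define u where "u n = cinner \<xi> (e n) *\<^sub>C e n" for n
  have ne: "norm (e n) = 1" for n
    by (rule norm_eq_1_cinner) (simp add: e)
  have nu: "norm (u n) = cmod (cinner \<xi> (e n))" for n
    by (simp add: u_def norm_scaleC ne)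
  have orth: "inner (u i) (u j) = 0" if "i \<noteq> j" for i j
    using that by (simp add: u_def Re_cinner [symmetric] cinner_scaleC_left cinner_scaleC_right e)
  have proj: "inner \<xi> (u i) = (norm (u i))\<^sup>2" for i
    unfolding nu Re_cinner [symmetric]
    by (simp add: u_def cinner_scaleC_right mult.commute complex_norm_square [symmetric] del: of_real_power)
  note sq = bessel(1) [of u \<xi>, OF orth proj]
  have "cinner (\<xi> - suminf u) (e m) = 0" for m
  proof -
    have "cinner (suminf u) (e m) = (\<Sum>n. cinner (u n) (e m))"
      by (rule bounded_linear.suminf [OF bounded_linear_cinner_left orthogonal_series(1) [OF orth sq]])
    also have "\<dots> = (\<Sum>n\<in>{m}. cinner (u n) (e m))"
      by (rule suminf_finite) (auto simp: u_def cinner_scaleC_left e)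
    also have "\<dots> = cinner \<xi> (e m)" by (simp add: u_def cinner_scaleC_left e)
    finally show ?thesis by (simp add: cinner_diff_left)
  qed
  then have "\<xi> = suminf u" using max [of "\<xi> - suminf u"] by simp
  then have "(norm \<xi>)\<^sup>2 = (\<Sum>n. (norm (u n))\<^sup>2)"
    using orthogonal_series(2) [OF orth sq] by simp
  then show ?thesis using sq by (simp add: nu summable_sums)
qed

text \<open>With an orthonormal basis \<open>e\<close>, the isometry \<open>v k\<close> sends \<open>e n\<close> to \<open>e (prod_encode (k, n))\<close>. Since
  \<open>prod_encode\<close> is injective, the images of the basis under different \<open>v k\<close> are disjoint.\<close>

lemma orthogonal_isometries_exist:
  assumes "separable_space (euclidean :: 'h::complex_hilbert topology)"
    and "infinite_dimensional TYPE('h::complex_hilbert)"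
  obtains v :: "nat \<Rightarrow> 'h::complex_hilbert \<Rightarrow>\<^sub>L 'h::complex_hilbert"
  where "\<And>k. v k \<in> bounded_operators" and "\<And>k \<xi>. norm (v k \<xi>) = norm \<xi>"
    and "\<And>j k \<xi> \<eta>. j \<noteq> k \<Longrightarrow> cinner (v j \<xi>) (v k \<eta>) = 0"
proof -
  obtain e :: "nat \<Rightarrow> 'h"
    where e: "\<And>m n. cinner (e m) (e n) = (if m = n then 1 else 0)"
      and max: "\<And>\<xi>. (\<And>n. cinner \<xi> (e n) = 0) \<Longrightarrow> \<xi> = 0"
    using orthonormal_basis_exists [OF assms] by blast
  note parseval = parseval [OF e max]
  define u where "u k \<xi> n = cinner \<xi> (e n) *\<^sub>C e (prod_encode (k, n))" for k \<xi> n
  define S where "S k \<xi> = suminf (u k \<xi>)" for k \<xi>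
  have nu: "(norm (u k \<xi> n))\<^sup>2 = (cmod (cinner \<xi> (e n)))\<^sup>2" for k \<xi> n
    using norm_eq_1_cinner [of "e (prod_encode (k, n))"] e
    by (simp add: u_def norm_scaleC)
  have orth: "inner (u k \<xi> i) (u k \<xi> j) = 0" if "i \<noteq> j" for k \<xi> i j
    using that by (simp add: u_def Re_cinner [symmetric] cinner_scaleC_left cinner_scaleC_right e)
  have sq: "summable (\<lambda>n. (norm (u k \<xi> n))\<^sup>2)" for k \<xi>
    using parseval by (simp add: nu sums_iff)
  have summ: "summable (u k \<xi>)" for k \<xi>
    by (rule orthogonal_series(1) [OF orth sq])
  have "(norm (S k \<xi>))\<^sup>2 = (norm \<xi>)\<^sup>2" for k \<xi>
  proof -
    have "(norm (S k \<xi>))\<^sup>2 = (\<Sum>n. (norm (u k \<xi> n))\<^sup>2)"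
      unfolding S_def by (rule orthogonal_series(2) [OF orth sq])
    also have "\<dots> = (norm \<xi>)\<^sup>2"
      unfolding nu by (rule sums_unique [OF parseval, symmetric])
    finally show ?thesis .
  qed
  then have iso: "norm (S k \<xi>) = norm \<xi>" for k \<xi>
    by (rule power2_eq_imp_eq) simp_all
  have S_scaleC: "S k (c *\<^sub>C \<xi>) = c *\<^sub>C S k \<xi>" for k c \<xi>
    unfolding S_def bounded_linear.suminf [OF bounded_linear_scaleC summ]
    by (simp add: u_def [abs_def] cinner_scaleC_left)
  have "bounded_linear (S k)" for k
  proof (rule bounded_linear_intro)
    show "S k (\<xi> + \<eta>) = S k \<xi> + S k \<eta>" for \<xi> \<eta>
      unfolding S_def suminf_add [OF summ summ] by (simp add: u_def [abs_def] cinner_add_left scaleC_add_left)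
    show "S k (r *\<^sub>R \<xi>) = r *\<^sub>R S k \<xi>" for r \<xi> by (simp add: scaleR_scaleC S_scaleC)
    show "norm (S k \<xi>) \<le> norm \<xi> * 1" for \<xi> by (simp add: iso)
  qed
  then have app: "blinfun_apply (Blinfun (S k)) = S k" for k by (rule bounded_linear_Blinfun_apply)
  have orthS: "cinner (S j \<xi>) (S k \<eta>) = 0" if "j \<noteq> k" for j k \<xi> \<eta>
  proof -
    have "cinner (u j \<xi> n) (S k \<eta>) = 0" for n
    proof -
      have "cinner (S k \<eta>) (u j \<xi> n) = (\<Sum>m. cinner (u k \<eta> m) (u j \<xi> n))"
        unfolding S_def by (rule bounded_linear.suminf [OF bounded_linear_cinner_left summ])
      also have "\<dots> = 0"
        using that by (simp add: u_def cinner_scaleC_left cinner_scaleC_right e)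
      finally show ?thesis using cinner_commute [of "u j \<xi> n"] by simp
    qed
    then show ?thesis
      unfolding S_def [of j] using bounded_linear.suminf [OF bounded_linear_cinner_left summ]
      by simp
  qed
  show ?thesis
    by (rule that [of "\<lambda>k. Blinfun (S k)"])
      (simp_all add: app iso orthS S_scaleC bounded_operators_def)
qed


section \<open>Adjoints\<close>

lemma adj_bounded_operators:
  assumes a: "a \<in> bounded_operators"
  shows "adj a \<in> bounded_operators"
proof -
  have "adj a (c *\<^sub>C \<eta>) = c *\<^sub>C adj a \<eta>" for c \<eta>
    by (subst cinner_eq_iff' [symmetric]) (simp add: cinner_adj [OF a, symmetric] cinner_scaleC_right)
  then show ?thesis by (simp add: bounded_operators_def)
qed

lemma cinner_adj_left:
  assumes "a \<in> bounded_operators"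
  shows "cinner (adj a \<xi>) \<eta> = cinner \<xi> (a \<eta>)"
  using cinner_adj [OF assms, of \<eta> \<xi>] by (metis cinner_commute)

lemma inner_adj_left:
  assumes "a \<in> bounded_operators"
  shows "inner (adj a \<xi>) \<eta> = inner \<xi> (a \<eta>)"
  using cinner_adj_left [OF assms] by (simp add: Re_cinner [symmetric])

text \<open>Cancel one factor in \<open>\<parallel>a\<^sup>* \<eta>\<parallel>\<^sup>2 = \<langle>\<eta>, a a\<^sup>* \<eta>\<rangle> \<le> \<parallel>\<eta>\<parallel> \<parallel>a\<parallel> \<parallel>a\<^sup>* \<eta>\<parallel>\<close>.\<close>

lemma norm_adj_le:
  assumes a: "a \<in> bounded_operators"
  shows "norm (adj a) \<le> norm a"
proof (rule norm_blinfun_bound)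
  fix \<eta>
  have "norm (adj a \<eta>) * norm (adj a \<eta>) = inner \<eta> (a (adj a \<eta>))"
    by (simp add: inner_adj_left [OF a, symmetric] power2_norm_eq_inner [symmetric] power2_eq_square)
  also have "\<dots> \<le> norm \<eta> * (norm a * norm (adj a \<eta>))"
    by (intro order_trans [OF norm_cauchy_schwarz] mult_left_mono norm_blinfun) simp
  finally have "norm (adj a \<eta>) * norm (adj a \<eta>) \<le> (norm a * norm \<eta>) * norm (adj a \<eta>)"
    by (simp add: ac_simps)
  then show "norm (adj a \<eta>) \<le> norm a * norm \<eta>"
    by (cases "adj a \<eta> = 0") (auto dest: mult_right_le_imp_le)
qed simp

text \<open>By polarisation, an isometry preserves inner products.\<close>

lemma adj_isometry:
  assumes v: "v \<in> bounded_operators" and iso: "\<And>\<xi>. norm (v \<xi>) = norm \<xi>"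
  shows "adj v (v \<xi>) = \<xi>"
proof -
  have "inner (v \<xi>) (v \<eta>) = inner \<xi> \<eta>" for \<eta>
    by (simp add: dot_norm iso blinfun.add_right [symmetric])
  then have "inner (adj v (v \<xi>)) \<eta> = inner \<xi> \<eta>" for \<eta>
    by (simp add: inner_adj_left [OF v])
  then show ?thesis by (metis vector_eq_rdot)
qed

lemma bounded_operators_compose:
  "a \<in> bounded_operators \<Longrightarrow> b \<in> bounded_operators \<Longrightarrow> a o\<^sub>L b \<in> bounded_operators"
  by (simp add: bounded_operators_def)

lemma id_bounded_operators: "id_blinfun \<in> bounded_operators"
  by (simp add: bounded_operators_def)

lemma closed_bounded_operators: "closed (bounded_operators :: ('a::complex_hilbert \<Rightarrow>\<^sub>L 'a) set)"
  unfolding bounded_operators_def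
  by (intro closed_Collect_all closed_Collect_eq continuous_intros
      bounded_linear.continuous_on [OF bounded_linear_scaleC])

text \<open>For an isometry \<open>v\<close>, the operator \<open>\<Phi>(v)\<^sup>* \<Phi>(v) = \<Phi>(1)\<close> is a projection, so \<open>\<Phi>(v)\<close> is a partial
  isometry; \<open>\<Phi>(1)\<close> may differ from \<open>1\<close>.\<close>

lemma star_homomorphism_norm_isometry:
  fixes v :: "'a::complex_hilbert \<Rightarrow>\<^sub>L 'a"
  assumes hom: "star_homomorphism A B \<Phi>"
    and B: "B \<subseteq> bounded_operators"
    and A: "v \<in> A" "adj v \<in> A" "id_blinfun \<in> A"
    and v: "adj v o\<^sub>L v = id_blinfun"
  shows "norm (\<Phi> v) \<le> 1"
proof -
  define P where "P = \<Phi> id_blinfun"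
  have mult: "\<Phi> (a o\<^sub>L b) = \<Phi> a o\<^sub>L \<Phi> b" if "a \<in> A" "b \<in> A" for a b
    using hom that by (simp add: star_homomorphism_def)
  have star: "\<Phi> (adj a) = adj (\<Phi> a)" if "a \<in> A" for a
    using hom that by (simp add: star_homomorphism_def)
  have "adj id_blinfun = (id_blinfun :: 'a \<Rightarrow>\<^sub>L 'a)" by (rule adj_unique) simp
  then have "adj P = P" using star [OF A(3)] by (simp add: P_def)
  have bo: "\<Phi> v \<in> bounded_operators" "P \<in> bounded_operators"
    using hom A B by (auto simp: star_homomorphism_def P_def)
  have "P o\<^sub>L P = P"
  proof -
    have "id_blinfun o\<^sub>L id_blinfun = (id_blinfun :: 'a \<Rightarrow>\<^sub>L 'a)" by (rule blinfun_eqI) simp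
    then show ?thesis using mult [OF A(3) A(3)] by (simp add: P_def)
  qed
  then have PP: "P (P \<xi>) = P \<xi>" for \<xi> by (metis blinfun_apply_blinfun_compose)
  have "adj (\<Phi> v) o\<^sub>L \<Phi> v = P"
    using mult [OF A(2) A(1)] star [OF A(1)] by (simp add: P_def v)
  then have vP: "adj (\<Phi> v) (\<Phi> v \<xi>) = P \<xi>" for \<xi> by (metis blinfun_apply_blinfun_compose)
  have P1: "norm (P \<xi>) \<le> norm \<xi>" for \<xi>
  proof -
    have "norm (P \<xi>) * norm (P \<xi>) = inner \<xi> (P \<xi>)"
      using inner_adj_left [OF bo(2), of \<xi> "P \<xi>"]
      by (simp add: \<open>adj P = P\<close> PP power2_norm_eq_inner [symmetric] power2_eq_square)
    also have "\<dots> \<le> norm \<xi> * norm (P \<xi>)" by (rule norm_cauchy_schwarz)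
    finally show ?thesis by (cases "P \<xi> = 0") (auto dest: mult_right_le_imp_le)
  qed
  show ?thesis
  proof (rule norm_blinfun_bound)
    fix \<xi>
    have "(norm (\<Phi> v \<xi>))\<^sup>2 = inner (P \<xi>) \<xi>"
      using inner_adj_left [OF bo(1), of "\<Phi> v \<xi>" \<xi>] by (simp add: vP power2_norm_eq_inner)
    also have "\<dots> \<le> norm \<xi> * norm \<xi>"
      by (intro order_trans [OF norm_cauchy_schwarz] mult_right_mono P1) simp
    finally show "norm (\<Phi> v \<xi>) \<le> 1 * norm \<xi>"
      unfolding power2_eq_square [of "norm \<xi>", symmetric] mult_1 by (rule power2_le_imp_le) simp
  qed simp
qed


section \<open>Propagation\<close>

lemma entry_eq_0_iff: "entry a x y = 0 \<longleftrightarrow> (\<forall>\<xi>. ell2_apply (a (delta x \<xi>)) y = 0)"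
  by (auto simp: blinfun_apply_entry [symmetric] intro: blinfun_eqI)

lemma propagation_le_iff:
  assumes "0 \<le> r"
  shows "propagation a \<le> ennreal r \<longleftrightarrow> (\<forall>x y. r < dist x y \<longrightarrow> entry a x y = 0)"
proof -
  have "ennreal (dist x y) \<le> ennreal r \<longleftrightarrow> \<not> r < dist x y" for x y :: 'a
    using assms by (simp add: ennreal_le_iff not_less)
  then show ?thesis unfolding propagation_def Sup_le_iff by blast
qed

lemma finite_propagation_bound:
  assumes "propagation a < \<infinity>"
  obtains t where "0 \<le> t" and "propagation a \<le> ennreal t"
  by (rule that [of "enn2real (propagation a)"])
    (use assms in \<open>simp_all add: infinity_ennreal_def\<close>)

text \<open>The matrix of \<open>a\<^sup>*\<close> is supported on the transposed support of the matrix of \<open>a\<close>.\<close>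

lemma ell2_apply_adj_delta:
  assumes a: "a \<in> bounded_operators" and "entry a x y = 0"
  shows "ell2_apply (adj a (delta y \<eta>)) x = 0"
proof -
  have "cinner (ell2_apply (adj a (delta y \<eta>)) x) \<xi> = 0" for \<xi>
  proof -
    have "cinner (a (delta x \<xi>)) (delta y \<eta>) = 0"
      using assms(2) by (simp add: cinner_delta_right entry_eq_0_iff)
    then have "cinner (delta y \<eta>) (a (delta x \<xi>)) = 0"
      using cinner_commute [of "delta y \<eta>"] by simp
    then show ?thesis by (simp add: cinner_delta_right [symmetric] cinner_adj_left [OF a])
  qed
  then show ?thesis by (rule cinner_all_eq_0)
qed

lemma propagation_adj_le:
  assumes a: "a \<in> bounded_operators" and "0 \<le> r" and "propagation a \<le> ennreal r"
  shows "propagation (adj a) \<le> ennreal r"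
  using assms by (auto simp: propagation_le_iff entry_eq_0_iff [of "adj a"] dist_commute
      intro!: ell2_apply_adj_delta)

text \<open>The entry of \<open>a b\<close> at \<open>(x, y)\<close> is determined by the inner products of \<open>b (\<delta>\<^sub>x \<otimes> \<xi>)\<close>, which lives
  on the ball of radius \<open>s\<close> around \<open>x\<close>, with \<open>a\<^sup>* (\<delta>\<^sub>y \<otimes> \<eta>)\<close>, which lives on the ball of radius \<open>r\<close>
  around \<open>y\<close>. These balls are disjoint if \<open>x\<close> and \<open>y\<close> are further apart than \<open>r + s\<close>.\<close>

lemma propagation_compose_le:
  assumes a: "a \<in> bounded_operators" and b: "b \<in> bounded_operators"
    and r: "0 \<le> r" "propagation a \<le> ennreal r"
    and s: "0 \<le> s" "propagation b \<le> ennreal s"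
  shows "propagation (a o\<^sub>L b) \<le> ennreal (r + s)"
proof -
  have "ell2_apply (a (b (delta x \<xi>))) y = 0" if xy: "r + s < dist x y" for x y \<xi>
  proof -
    have "cinner (ell2_apply (a (b (delta x \<xi>))) y) \<eta> = 0" for \<eta>
    proof -
      have "cinner (ell2_apply (b (delta x \<xi>)) z) (ell2_apply (adj a (delta y \<eta>)) z) = 0" for z
      proof (cases "s < dist x z")
        case True
        then have "ell2_apply (b (delta x \<xi>)) z = 0"
          using s by (simp add: propagation_le_iff entry_eq_0_iff)
        then show ?thesis by simp
      next
        case False
        then have "r < dist z y" using xy dist_triangle [of x y z] by simp
        then have "entry a z y = 0" using r by (simp add: propagation_le_iff)
        then show ?thesis by (simp add: ell2_apply_adj_delta [OF a])
      qed
      then have "cinner (b (delta x \<xi>)) (adj a (delta y \<eta>)) = 0"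
        by (simp add: cinner_ell2.rep_eq)
      then show ?thesis by (simp add: cinner_delta_right [symmetric] cinner_adj [OF a])
    qed
    then show ?thesis by (rule cinner_all_eq_0)
  qed
  then show ?thesis
    by (subst propagation_le_iff) (use r(1) s(1) in \<open>auto simp: entry_eq_0_iff\<close>)
qed

text \<open>Matrix entries are continuous for the strong operator topology.\<close>

lemma propagation_sums_le:
  fixes A :: "('x::metric_space, 'h::complex_hilbert) ell2 \<Rightarrow>\<^sub>L ('x, 'h) ell2"
  assumes r: "0 \<le> r" "\<And>k. propagation (b k) \<le> ennreal r"
    and A: "\<And>f. (\<lambda>k. b k f) sums A f"
  shows "propagation A \<le> ennreal r"
proof -
  have lin: "bounded_linear (\<lambda>f :: ('x, 'h) ell2. ell2_apply f y)" for y
    by (rule bounded_linear_intro [where K = 1]) (simp_all add: norm_ell2_apply_le)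
  have "ell2_apply (A (delta x \<xi>)) y = 0" if "r < dist x y" for x y \<xi>
  proof -
    have "(\<lambda>k. ell2_apply (b k (delta x \<xi>)) y) sums ell2_apply (A (delta x \<xi>)) y"
      by (rule bounded_linear.sums [OF lin A])
    moreover have "ell2_apply (b k (delta x \<xi>)) y = 0" for k
      using r that by (simp add: propagation_le_iff entry_eq_0_iff)
    ultimately show ?thesis by (simp add: sums_iff)
  qed
  then show ?thesis using r(1) by (simp add: propagation_le_iff entry_eq_0_iff)
qed

lemma BD_subset_bounded_operators: "BD \<subseteq> bounded_operators"
  unfolding BD_def by (rule closure_minimal [OF _ closed_bounded_operators]) blast

lemma finite_propagation_in_BD:
  assumes "a \<in> bounded_operators" and "propagation a \<le> ennreal r"
  shows "a \<in> BD"
proof -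
  have "propagation a < \<infinity>"
    unfolding infinity_ennreal_def using assms(2) ennreal_less_top by (rule le_less_trans)
  then show ?thesis
    unfolding BD_def using assms(1) by (intro subsetD [OF closure_subset] CollectI conjI)
qed

lemma BD_approximation:
  assumes "a \<in> BD" and "0 < \<epsilon>"
  obtains c t where "c \<in> bounded_operators" and "0 \<le> t" and "propagation c \<le> ennreal t"
    and "norm (a - c) < \<epsilon>"
proof -
  obtain c where c: "c \<in> bounded_operators" "propagation c < \<infinity>" "dist c a < \<epsilon>"
    using assms unfolding BD_def closure_approachable by blast
  obtain t where t: "0 \<le> t" "propagation c \<le> ennreal t"
    using c(2) by (rule finite_propagation_bound)
  show ?thesis
    by (rule that [OF c(1) t]) (use c(3) in \<open>simp add: dist_norm norm_minus_commute\<close>)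
qed


section \<open>Amplified isometries and block-diagonal operators\<close>

lift_definition fibrewise :: "('h::complex_hilbert \<Rightarrow>\<^sub>L 'h) \<Rightarrow> ('x, 'h) ell2 \<Rightarrow> ('x, 'h) ell2"
  is "\<lambda>v f x. blinfun_apply v (f x)"
proof -
  fix v :: "'h \<Rightarrow>\<^sub>L 'h" and f :: "'x \<Rightarrow> 'h"
  assume f: "(\<lambda>x. (norm (f x))\<^sup>2) summable_on UNIV"
  show "(\<lambda>x. (norm (v (f x)))\<^sup>2) summable_on UNIV"
  proof (rule summable_on_comparison_test)
    show "(\<lambda>x. (norm v)\<^sup>2 * (norm (f x))\<^sup>2) summable_on UNIV"
      by (intro summable_on_cmult_right f)
    show "(norm (v (f x)))\<^sup>2 \<le> (norm v)\<^sup>2 * (norm (f x))\<^sup>2" for x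
      unfolding power_mult_distrib [symmetric] by (intro power_mono norm_blinfun) simp
  qed simp
qed

lemma amplified_isometries_exist:
  assumes "separable_space (euclidean :: 'h::complex_hilbert topology)"
    and "infinite_dimensional TYPE('h::complex_hilbert)"
  obtains V :: "nat \<Rightarrow> ('x::metric_space, 'h::complex_hilbert) ell2 \<Rightarrow>\<^sub>L ('x, 'h) ell2"
  where "\<And>k. V k \<in> bounded_operators" and "\<And>k. propagation (V k) \<le> ennreal 0"
    and "\<And>k f. norm (V k f) = norm f"
    and "\<And>j k f g. j \<noteq> k \<Longrightarrow> cinner (V j f) (V k g) = 0"
proof -
  obtain v :: "nat \<Rightarrow> 'h \<Rightarrow>\<^sub>L 'h"
    where v: "\<And>k. v k \<in> bounded_operators" and iso: "\<And>k \<xi>. norm (v k \<xi>) = norm \<xi>"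
      and orth: "\<And>j k \<xi> \<eta>. j \<noteq> k \<Longrightarrow> cinner (v j \<xi>) (v k \<eta>) = 0"
    using orthogonal_isometries_exist [OF assms] by blast
  have ell2_eqI: "f = g" if "\<And>x. ell2_apply f x = ell2_apply g x" for f g :: "('x, 'h) ell2"
    using that by (metis ell2_apply_inject ext)
  have isoF: "norm (fibrewise (v k) f) = norm f" for k and f :: "('x, 'h) ell2"
    by (rule power2_eq_imp_eq) (simp_all add: norm_ell2_squared fibrewise.rep_eq iso)
  have scaleF: "fibrewise (v k) (c *\<^sub>C f) = c *\<^sub>C fibrewise (v k) f" for k c and f :: "('x, 'h) ell2"
    using v by (intro ell2_eqI) (simp add: fibrewise.rep_eq bounded_operators_def)
  have "bounded_linear (fibrewise (v k) :: ('x, 'h) ell2 \<Rightarrow> _)" for k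
  proof (rule bounded_linear_intro)
    show "fibrewise (v k) (f + g) = fibrewise (v k) f + fibrewise (v k) g" for f g :: "('x, 'h) ell2"
      by (intro ell2_eqI) (simp add: fibrewise.rep_eq blinfun.add_right)
    show "fibrewise (v k) (r *\<^sub>R f) = r *\<^sub>R fibrewise (v k) f" for r and f :: "('x, 'h) ell2"
      by (simp add: scaleR_scaleC scaleF)
    show "norm (fibrewise (v k) f) \<le> norm f * 1" for f :: "('x, 'h) ell2"
      by (simp add: isoF)
  qed
  then have app: "blinfun_apply (Blinfun (fibrewise (v k))) = (fibrewise (v k) :: ('x, 'h) ell2 \<Rightarrow> _)" for k
    by (rule bounded_linear_Blinfun_apply)
  show ?thesis
  proof (rule that [of "\<lambda>k. Blinfun (fibrewise (v k))"])
    show "(Blinfun (fibrewise (v k)) :: ('x, 'h) ell2 \<Rightarrow>\<^sub>L _) \<in> bounded_operators" for k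
      by (simp add: bounded_operators_def app scaleF)
    show "propagation (Blinfun (fibrewise (v k)) :: ('x, 'h) ell2 \<Rightarrow>\<^sub>L _) \<le> ennreal 0" for k
      by (subst propagation_le_iff) (auto simp: entry_eq_0_iff app fibrewise.rep_eq ell2_apply_delta)
    show "norm (Blinfun (fibrewise (v k)) f) = norm f" for k and f :: "('x, 'h) ell2"
      by (simp add: app isoF)
    show "cinner (Blinfun (fibrewise (v j)) f) (Blinfun (fibrewise (v k)) g) = 0"
      if "j \<noteq> k" for j k and f g :: "('x, 'h) ell2"
      using that by (simp add: app cinner_ell2.rep_eq fibrewise.rep_eq orth)
  qed
qed

text \<open>The terms \<open>V\<^sub>k a\<^sub>k V\<^sub>k\<^sup>* f\<close> are pairwise orthogonal and no longer than the components
  \<open>V\<^sub>k V\<^sub>k\<^sup>* f\<close> of \<open>f\<close> in the ranges of the \<open>V\<^sub>k\<close>, whose squared norms sum to at most \<open>\<parallel>f\<parallel>\<^sup>2\<close> by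
  Bessel's inequality. Hence the series converges strongly to a bounded operator. Compressing to the
  range of \<open>V\<^sub>k\<close> leaves only the term \<open>k\<close>.\<close>

lemma block_diagonal_operator:
  fixes V a :: "nat \<Rightarrow> 'a::complex_hilbert \<Rightarrow>\<^sub>L 'a"
  assumes V: "\<And>k. V k \<in> bounded_operators" and iso: "\<And>k f. norm (V k f) = norm f"
    and orth: "\<And>j k f g. j \<noteq> k \<Longrightarrow> cinner (V j f) (V k g) = 0"
    and a: "\<And>k. a k \<in> bounded_operators" and a1: "\<And>k. norm (a k) \<le> 1"
  shows "\<exists>A\<in>bounded_operators. (\<forall>f. (\<lambda>k. (V k o\<^sub>L a k o\<^sub>L adj (V k)) f) sums blinfun_apply A f) \<and>
    (\<forall>k. adj (V k) o\<^sub>L A o\<^sub>L V k = a k)"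
proof -
  define p where "p f k = V k (adj (V k) f)" for f k
  define u where "u f k = V k (a k (adj (V k) f))" for f k
  define S where "S f = suminf (u f)" for f
  have iorth: "inner (V j f) (V k g) = 0" if "j \<noteq> k" for j k f g
    using orth [OF that] by (simp add: Re_cinner [symmetric])
  have p_orth: "inner (p f i) (p f j) = 0" if "i \<noteq> j" for f i j
    using iorth [OF that] by (simp add: p_def)
  have p_proj: "inner f (p f k) = (norm (p f k))\<^sup>2" for f k
    by (simp add: p_def iso inner_adj_left [OF V, symmetric] power2_norm_eq_inner)
  note p_bessel = bessel [of "p f" f for f, OF p_orth p_proj]
  have u_orth: "inner (u f i) (u f j) = 0" if "i \<noteq> j" for f i j
    using iorth [OF that] by (simp add: u_def)
  have u_le: "(norm (u f k))\<^sup>2 \<le> (norm (p f k))\<^sup>2" for f k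
  proof -
    have "norm (a k (adj (V k) f)) \<le> 1 * norm (adj (V k) f)"
      by (intro order_trans [OF norm_blinfun] mult_right_mono a1) simp
    then show ?thesis by (simp add: u_def p_def iso)
  qed
  have sq: "summable (\<lambda>k. (norm (u f k))\<^sup>2)" for f
  proof (rule summable_comparison_test' [OF p_bessel(1) [of f]])
    show "norm ((norm (u f k))\<^sup>2) \<le> (norm (p f k))\<^sup>2" for k
      using u_le [of f k] by (metis abs_power2 real_norm_def)
  qed
  have summ: "summable (u f)" for f by (rule orthogonal_series(1) [OF u_orth sq])
  have "(norm (S f))\<^sup>2 \<le> (norm f)\<^sup>2" for f
  proof -
    have "(norm (S f))\<^sup>2 = (\<Sum>k. (norm (u f k))\<^sup>2)"
      unfolding S_def by (rule orthogonal_series(2) [OF u_orth sq])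
    also have "\<dots> \<le> (\<Sum>k. (norm (p f k))\<^sup>2)" by (intro suminf_le u_le sq p_bessel)
    also have "\<dots> \<le> (norm f)\<^sup>2" by (rule p_bessel)
    finally show ?thesis .
  qed
  then have S1: "norm (S f) \<le> norm f" for f by (rule power2_le_imp_le) simp
  have S_scaleC: "S (c *\<^sub>C f) = c *\<^sub>C S f" for c f
    unfolding S_def bounded_linear.suminf [OF bounded_linear_scaleC summ]
    using V a adj_bounded_operators [OF V] by (simp add: u_def [abs_def] bounded_operators_def)
  have "bounded_linear S"
  proof (rule bounded_linear_intro)
    show "S (f + g) = S f + S g" for f g
      unfolding S_def suminf_add [OF summ summ] by (simp add: u_def [abs_def] blinfun.add_right)
    show "S (r *\<^sub>R f) = r *\<^sub>R S f" for r f by (simp add: scaleR_scaleC S_scaleC)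
    show "norm (S f) \<le> norm f * 1" for f by (simp add: S1)
  qed
  then have app: "blinfun_apply (Blinfun S) = S" by (rule bounded_linear_Blinfun_apply)
  show ?thesis
  proof (intro bexI [of _ "Blinfun S"] conjI allI)
    show "Blinfun S \<in> bounded_operators" by (simp add: bounded_operators_def app S_scaleC)
    show "(\<lambda>k. (V k o\<^sub>L a k o\<^sub>L adj (V k)) f) sums Blinfun S f" for f
    proof -
      have "(\<lambda>k. (V k o\<^sub>L a k o\<^sub>L adj (V k)) f) = u f" by (rule ext) (simp add: u_def)
      then show ?thesis by (simp only: app S_def summable_sums [OF summ])
    qed
    show "adj (V k) o\<^sub>L Blinfun S o\<^sub>L V k = a k" for k
    proof (rule blinfun_eqI)
      fix f
      have "adj (V j) (V k f) = 0" if "j \<noteq> k" for j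
        by (rule cinner_all_eq_0) (simp add: cinner_adj_left [OF V] orth that [symmetric])
      then have "S (V k f) = (\<Sum>j\<in>{k}. u (V k f) j)"
        unfolding S_def by (intro suminf_finite) (auto simp: u_def)
      then show "(adj (V k) o\<^sub>L Blinfun S o\<^sub>L V k) f = a k f"
        by (simp add: app u_def adj_isometry [OF V iso])
    qed
  qed
qed


section \<open>Coarse-likeness\<close>

text \<open>The difference telescopes into \<open>E (A - c) D + (E - e) c D + e c (D - d)\<close>, where \<open>\<parallel>e\<parallel> \<le> 2\<close>.
  Only the norm of \<open>c\<close> enters the error, so that for a fixed \<open>c\<close> it tends to \<open>\<parallel>A - c\<parallel>\<close> with \<open>\<delta>\<close>.\<close>

lemma norm_sandwich_diff_le:
  fixes A c :: "'b::real_normed_vector \<Rightarrow>\<^sub>L 'c::real_normed_vector"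
    and D d :: "'a::real_normed_vector \<Rightarrow>\<^sub>L 'b" and E e :: "'c \<Rightarrow>\<^sub>L 'd::real_normed_vector"
  assumes E: "norm E \<le> 1" and D: "norm D \<le> 1" and \<delta>1: "\<delta> \<le> 1"
    and e: "norm (E - e) \<le> \<delta>" and d: "norm (D - d) \<le> \<delta>"
  shows "norm ((E o\<^sub>L A o\<^sub>L D) - (e o\<^sub>L c o\<^sub>L d)) \<le> norm (A - c) + 3 * \<delta> * norm c"
proof -
  have comp: "norm (x o\<^sub>L y o\<^sub>L z) \<le> \<alpha> * norm y * \<gamma>" if "norm x \<le> \<alpha>" "norm z \<le> \<gamma>"
    for x :: "'c \<Rightarrow>\<^sub>L 'd" and y :: "'b \<Rightarrow>\<^sub>L 'c" and z :: "'a \<Rightarrow>\<^sub>L 'b" and \<alpha> \<gamma>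
  proof -
    have "norm (x o\<^sub>L y o\<^sub>L z) \<le> norm x * norm y * norm z"
      by (intro order_trans [OF norm_blinfun_compose] mult_right_mono norm_blinfun_compose) simp
    also have "\<dots> \<le> \<alpha> * norm y * \<gamma>"
      using that order_trans [OF norm_ge_zero that(1)] by (intro mult_mono mult_nonneg_nonneg) auto
    finally show ?thesis .
  qed
  have e2: "norm e \<le> 2"
    using norm_triangle_ineq4 [of E "E - e"] E e \<delta>1 by simp
  have "(E o\<^sub>L A o\<^sub>L D) - (e o\<^sub>L c o\<^sub>L d) =
      (E o\<^sub>L (A - c) o\<^sub>L D) + ((E - e) o\<^sub>L c o\<^sub>L D) + (e o\<^sub>L c o\<^sub>L (D - d))"
    by (rule blinfun_eqI) (simp add: blinfun.diff_left blinfun.diff_right blinfun.add_left)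
  also have "norm \<dots> \<le> 1 * norm (A - c) * 1 + \<delta> * norm c * 1 + 2 * norm c * \<delta>"
    by (intro norm_triangle_mono comp E D e d e2)
  finally show ?thesis by simp
qed

text \<open>The order of the choices matters: \<open>d k\<close> and \<open>e k\<close> first, then \<open>a k\<close> depending on their
  propagation, then \<open>A\<close>, its approximant \<open>c\<close>, and finally the index \<open>k\<close>.\<close>

theorem theorem3p5:
  fixes \<Phi> :: "(('x::metric_space, 'h::complex_hilbert) ell2 \<Rightarrow>\<^sub>L ('x, 'h) ell2) \<Rightarrow>
      (('y::metric_space, 'h) ell2 \<Rightarrow>\<^sub>L ('y, 'h) ell2)"
  assumes "separable_space (euclidean :: 'h topology)"
    and "infinite_dimensional TYPE('h)"
    and "uniformly_locally_finite (UNIV :: 'x set)"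
    and "uniformly_locally_finite (UNIV :: 'y set)"
    and "star_homomorphism BD BD \<Phi>"
    and "strongly_continuous BD BD \<Phi>"
    and "compact_preserving BD \<Phi>"
  shows "coarse_like \<Phi>"
  unfolding coarse_like_def
proof (intro allI impI, rule ccontr)
  fix \<epsilon> r :: real assume \<epsilon>: "\<epsilon> > 0" and r: "r > 0"
  assume "\<not> (\<exists>s>0. \<forall>a\<in>BD. norm a \<le> 1 \<and> propagation a \<le> ennreal r \<longrightarrow>
      (\<exists>c\<in>BD. propagation c \<le> ennreal s \<and> norm (\<Phi> a - c) \<le> \<epsilon>))"
  then have bad: "\<exists>a\<in>BD. norm a \<le> 1 \<and> propagation a \<le> ennreal r \<and>
      (\<forall>c\<in>BD. propagation c \<le> ennreal s \<longrightarrow> \<not> norm (\<Phi> a - c) \<le> \<epsilon>)" if "s > 0" for s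
    using that by blast
  note hom = \<open>star_homomorphism BD BD \<Phi>\<close>
  obtain V :: "nat \<Rightarrow> ('x, 'h) ell2 \<Rightarrow>\<^sub>L ('x, 'h) ell2"
    where V: "\<And>k. V k \<in> bounded_operators" "\<And>k. propagation (V k) \<le> ennreal 0"
      and iso: "\<And>k f. norm (V k f) = norm f"
      and orth: "\<And>j k f g. j \<noteq> k \<Longrightarrow> cinner (V j f) (V k g) = 0"
    using amplified_isometries_exist [OF assms(1,2)] by blast
  have W: "adj (V k) \<in> bounded_operators" "propagation (adj (V k)) \<le> ennreal 0" for k
    using adj_bounded_operators [OF V(1)] propagation_adj_le [OF V(1) order_refl V(2)] by blast+
  have BD: "V k \<in> BD" "adj (V k) \<in> BD" "id_blinfun \<in> (BD :: (('x, 'h) ell2 \<Rightarrow>\<^sub>L ('x, 'h) ell2) set)" for k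
  proof -
    show "V k \<in> BD" "adj (V k) \<in> BD" using V W by (auto intro: finite_propagation_in_BD)
    have "propagation (id_blinfun :: ('x, 'h) ell2 \<Rightarrow>\<^sub>L ('x, 'h) ell2) \<le> ennreal 0"
      by (subst propagation_le_iff) (auto simp: entry_eq_0_iff ell2_apply_delta)
    then show "id_blinfun \<in> (BD :: (('x, 'h) ell2 \<Rightarrow>\<^sub>L ('x, 'h) ell2) set)"
      by (rule finite_propagation_in_BD [OF id_bounded_operators])
  qed
  have "adj (V k) o\<^sub>L V k = id_blinfun" for k
    by (rule blinfun_eqI) (simp add: adj_isometry [OF V(1) iso])
  then have norm_\<Phi>V: "norm (\<Phi> (V k)) \<le> 1" for k
    by (rule star_homomorphism_norm_isometry [OF hom BD_subset_bounded_operators BD])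
  have norm_\<Phi>W: "norm (\<Phi> (adj (V k))) \<le> 1" for k
  proof -
    have "\<Phi> (V k) \<in> bounded_operators" "\<Phi> (adj (V k)) = adj (\<Phi> (V k))"
      using hom BD BD_subset_bounded_operators by (auto simp: star_homomorphism_def)
    then show ?thesis using norm_adj_le [of "\<Phi> (V k)"] norm_\<Phi>V [of k] by simp
  qed
  have \<Phi>BD: "\<Phi> a \<in> BD" if "a \<in> BD" for a using hom that by (auto simp: star_homomorphism_def)
  have "\<exists>d t. d \<in> bounded_operators \<and> 0 \<le> t \<and> propagation d \<le> ennreal t \<and>
      norm (\<Phi> (V k) - d) < 1 / real (Suc k)" for k
    by (rule BD_approximation [OF \<Phi>BD [OF BD(1) [of k]], of "1 / real (Suc k)"]) auto
  then obtain d t where d: "\<And>k. d k \<in> bounded_operators" "\<And>k. 0 \<le> t k"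
    "\<And>k. propagation (d k) \<le> ennreal (t k)" "\<And>k. norm (\<Phi> (V k) - d k) < 1 / real (Suc k)"
    by metis
  have "\<exists>e t. e \<in> bounded_operators \<and> 0 \<le> t \<and> propagation e \<le> ennreal t \<and>
      norm (\<Phi> (adj (V k)) - e) < 1 / real (Suc k)" for k
    by (rule BD_approximation [OF \<Phi>BD [OF BD(2) [of k]], of "1 / real (Suc k)"]) auto
  then obtain e t' where e: "\<And>k. e k \<in> bounded_operators" "\<And>k. 0 \<le> t' k"
    "\<And>k. propagation (e k) \<le> ennreal (t' k)" "\<And>k. norm (\<Phi> (adj (V k)) - e k) < 1 / real (Suc k)"
    by metis
  have "\<exists>a\<in>BD. norm a \<le> 1 \<and> propagation a \<le> ennreal r \<and>
      (\<forall>c\<in>BD. propagation c \<le> ennreal (t' k + real (Suc k) + t k) \<longrightarrow> \<not> norm (\<Phi> a - c) \<le> \<epsilon>)" for k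
    by (rule bad) (use d(2) [of k] e(2) [of k] in simp)
  then obtain a where a: "\<And>k. a k \<in> BD" "\<And>k. norm (a k) \<le> 1" "\<And>k. propagation (a k) \<le> ennreal r"
    and a_bad: "\<And>k c. c \<in> BD \<Longrightarrow> propagation c \<le> ennreal (t' k + real (Suc k) + t k) \<Longrightarrow>
      \<not> norm (\<Phi> (a k) - c) \<le> \<epsilon>"
    by metis
  have a_bo: "a k \<in> bounded_operators" for k using a(1) BD_subset_bounded_operators by blast
  obtain A where A: "A \<in> bounded_operators"
    and A_sums: "\<forall>f. (\<lambda>k. (V k o\<^sub>L a k o\<^sub>L adj (V k)) f) sums A f"
    and A_corner: "\<forall>k. adj (V k) o\<^sub>L A o\<^sub>L V k = a k"
    using block_diagonal_operator [of V a, OF V(1) iso orth a_bo a(2)] by blast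
  have "propagation (V k o\<^sub>L a k o\<^sub>L adj (V k)) \<le> ennreal (0 + r + 0)" for k
    using r V W a a_bo by (intro propagation_compose_le bounded_operators_compose) auto
  then have blocks: "propagation (V k o\<^sub>L a k o\<^sub>L adj (V k)) \<le> ennreal r" for k by simp
  have "propagation A \<le> ennreal r"
    by (rule propagation_sums_le [OF less_imp_le [OF r] blocks A_sums [rule_format]])
  then have "A \<in> BD" by (rule finite_propagation_in_BD [OF A])
  obtain c s where c: "c \<in> bounded_operators" "0 \<le> s" "propagation c \<le> ennreal s"
      "norm (\<Phi> A - c) < \<epsilon> / 2"
    by (rule BD_approximation [OF \<Phi>BD [OF \<open>A \<in> BD\<close>], of "\<epsilon> / 2"]) (use \<epsilon> in auto)
  \<comment> \<open>One index beats both the propagation of \<open>c\<close> and the error \<open>3 * norm c / Suc k\<close>.\<close>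
  obtain k :: nat where k: "max s (6 * norm c / \<epsilon>) \<le> real k" using real_arch_simple by blast
  have "propagation (adj (V k) o\<^sub>L A) \<le> ennreal (0 + r)"
    using r W A \<open>propagation A \<le> ennreal r\<close> by (intro propagation_compose_le) auto
  then have "adj (V k) o\<^sub>L A \<in> BD"
    using W A by (intro finite_propagation_in_BD bounded_operators_compose)
  then have \<Phi>a: "\<Phi> (a k) = \<Phi> (adj (V k)) o\<^sub>L \<Phi> A o\<^sub>L \<Phi> (V k)"
    using hom BD \<open>A \<in> BD\<close> by (simp add: A_corner [rule_format, symmetric] star_homomorphism_def)
  have "norm (\<Phi> (a k) - (e k o\<^sub>L c o\<^sub>L d k)) \<le> norm (\<Phi> A - c) + 3 * (1 / real (Suc k)) * norm c"
    unfolding \<Phi>a using d(4) [of k] e(4) [of k]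
    by (intro norm_sandwich_diff_le norm_\<Phi>V norm_\<Phi>W) auto
  also have "\<dots> \<le> \<epsilon>"
  proof -
    have "6 * norm c \<le> \<epsilon> * real k" using k \<epsilon> by (simp add: pos_divide_le_eq mult.commute)
    also have "\<dots> \<le> \<epsilon> * real (Suc k)" using \<epsilon> by simp
    finally have "3 * (1 / real (Suc k)) * norm c \<le> \<epsilon> / 2" by (simp add: field_simps)
    then show ?thesis using c(4) by simp
  qed
  finally have close: "norm (\<Phi> (a k) - (e k o\<^sub>L c o\<^sub>L d k)) \<le> \<epsilon>" .
  have bo: "e k o\<^sub>L c o\<^sub>L d k \<in> bounded_operators"
    by (intro bounded_operators_compose c d e)
  have "propagation c \<le> ennreal (real (Suc k))"
    using c(3) k by (elim order_trans) (intro ennreal_leI, simp)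
  then have "propagation (e k o\<^sub>L c o\<^sub>L d k) \<le> ennreal (t' k + real (Suc k) + t k)"
    by (intro propagation_compose_le bounded_operators_compose c d e add_nonneg_nonneg) auto
  then show False using a_bad [OF finite_propagation_in_BD [OF bo]] close by blast
qed

end
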